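(* Let $f:[a,b]\times\mathcal{Z}\to[a,b]$ be measurable and monotone increasing in the first argument (for each $z\in\mathcal{Z}$ and $a\le x_1\le x_2\le b$, $f(x_1,z)\le f(x_2,z)$). Let $\{Z_t\}_{t\ge 0}$ be a regenerative sequence on $(\mathcal{Z},\mathcal{B}_{\mathcal{Z}})$ with regenerative times $\{T_n\}$ and cycle lengths $\tau_n=T_n-T_{n-1}$, satisfying $\mathbf{E}\tau_1<\infty$ and $\mathrm{G.C.D.}\{n:\mathbf{P}(\tau_1=n)>0\}=1$. Let $X_{t+1}=f(X_t,Z_t)$, $t=0,1,\ldots$, with $X_0\in[a,b]$. Assume that there exists $c\in[a,b]$ such that $$\varepsilon_1:=\mathbf{P}\bigl(\widetilde{X}^{(b)}_{T_1-T_0}\le c\bigr)>0\quad\text{and}\quad \varepsilon_2:=\mathbf{P}\bigl(\widetilde{X}^{(a)}_{T_1-T_0}\ge c\bigr)>0 .$$ Then: (1) There exists a probability distribution $\pi$ on $[a,b]$ such that $$\sup_{x\in[a,b]}\sup_{r}\bigl|G_n^{(x)}(r)-\pi(-\infty,r]\bigr|\to 0\quad\text{exponentially fast as } n\to\infty,$$ where $G_n^{(x)}$ is the distribution (function) of $X_{T_n}$ if $X_{T_0}=x$. (2) For any initial value $X_0$, the distributions of $X_t$ converge, as $t\to\infty$, in the uniform metric to the distribution $$\mu(\cdot)=\frac{1}{\mathbf{E}(\tau_1)}\sum_{l=0}^{\infty}\mathbf{P}\Bigl(\tau_1>l,\ f^{(l)}\bigl(\widetilde{X}_0^{(\pi)},Z_{T_0},\ldots,Z_{T_0+l-1}\bigr)\in\cdot\Bigr).$$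 (3) For any initial value $X_0$, as $t\to\infty$, $$\sup_r\sup_{A\in\mathcal{B}_{\mathcal{Z}}}\Bigl|\mathbf{P}(X_t\le r,Z_t\in A)-\frac{1}{\mathbf{E}(\tau_1)}\sum_{l=0}^{\infty}\mathbf{P}\Bigl(\tau_1>l,\ f^{(l)}\bigl(\widetilde{X}_0^{(\pi)},Z_{T_0},\ldots,Z_{T_0+l-1}\bigr)\le r,\ Z_{T_0+l}\in A\Bigr)\Bigr|\to 0.$$
   Context: The state space is a closed interval $[a,b]\subset\mathbb{R}$, $a<b$; $(\mathcal{Z},\mathcal{B}_{\mathcal{Z}})$ is a general measurable space. Regenerative sequence: $\{Z_t\}_{t\ge 0}$ with values in $\mathcal{Z}$ is regenerative if there is an increasing sequence of integer-valued random variables $0=T_{-1}\le T_0<T_1<T_2<\cdots$ such that, with $\tau_n=T_n-T_{n-1}$ for $n\ge 0$, the vectors (cycles) $\{\tau_n,Z_{T_{n-1}},\ldots,Z_{T_n-1}\}$ are independent for $n\ge 0$ and identically distributed for $n\ge 1$. The initial value $X_0=x\in[a,b]$ of the recursion is a given (nonrandom) point. Auxiliary process: for $\alpha\in[a,b]$, $\widetilde X_0^{(\alpha)}=\alpha$ and $\widetilde X_{t+1}^{(\alpha)}=f(\widetilde X_t^{(\alpha)},Z_{T_0+t})$ for $t\ge 0$. For a probability distribution $F$ on $[a,b]$, $\widetilde X_0^{(F)}$ denotes a random variable with distribution $F$ independent of the random variables of the regenerative sequence from time $T_0$ on (of the cycles starting at $T_0$, in particular of $\{Z_{T_0+t},t\ge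 0\}$ and $\tau_1$). Iterates: $f^{(0)}$ is the identity function $f^{(0)}(x)=x$, $f^{(1)}=f$, and $f^{(k+1)}(x,u_1,\ldots,u_{k+1})=f\bigl(f^{(k)}(x,u_1,\ldots,u_k),u_{k+1}\bigr)$ for $k\ge 1$. Uniform (Kolmogorov) metric between probability distributions on the real line with distribution functions $F,G$: $d(F,G)=\sup_x|F(x)-G(x)|$. *)

theory Defs
  imports "HOL-Probability.Probability"
begin

text \<open>Convention: \<open>T n\<close> is the regenerative time $T_n$ for $n \ge 0$; the time $T_{-1} = 0$ is implicit.\<close>

definition prev_time :: "(nat \<Rightarrow> 'w \<Rightarrow> nat) \<Rightarrow> nat \<Rightarrow> 'w \<Rightarrow> nat" where
  "prev_time T n \<omega> = (case n of 0 \<Rightarrow> 0 | Suc m \<Rightarrow> T m \<omega>)"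

definition cycle_length :: "(nat \<Rightarrow> 'w \<Rightarrow> nat) \<Rightarrow> nat \<Rightarrow> 'w \<Rightarrow> nat" where
  "cycle_length T n \<omega> = T n \<omega> - prev_time T n \<omega>"

text \<open>A cycle is a vector of random length, modelled as a list; its length is the cycle length
  $\tau_n$, which therefore need not be recorded separately.  The $\sigma$-algebra on lists is the
  one of the disjoint union of the finite powers of \<open>S\<close>: it is generated by the
  rectangles $A_1 \times \cdots \times A_n$ of all lengths $n \ge 0$.\<close>

definition cycle_space :: "'z measure \<Rightarrow> 'z list measure" where
  "cycle_space S = sigma (lists (space S)) {listset As | As. set As \<subseteq> sets S}"

definition cycle :: "(nat \<Rightarrow> 'w \<Rightarrow> 'z) \<Rightarrow> (nat \<Rightarrow> 'w \<Rightarrow> nat) \<Rightarrow> nat \<Rightarrow> 'w \<Rightarrow> 'z list" where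
  "cycle Z T n \<omega> = map (\<lambda>t. Z t \<omega>) [prev_time T n \<omega> ..< T n \<omega>]"

definition regenerative ::
  "'w measure \<Rightarrow> 'z measure \<Rightarrow> (nat \<Rightarrow> 'w \<Rightarrow> 'z) \<Rightarrow> (nat \<Rightarrow> 'w \<Rightarrow> nat) \<Rightarrow> bool" where
  "regenerative M S Z T \<longleftrightarrow>
     (\<forall>t. Z t \<in> M \<rightarrow>\<^sub>M S) \<and>
     (\<forall>n. T n \<in> M \<rightarrow>\<^sub>M count_space UNIV) \<and>
     (\<forall>n. \<forall>\<omega>\<in>space M. T n \<omega> < T (Suc n) \<omega>) \<and>
     prob_space.indep_vars M (\<lambda>_. cycle_space S) (cycle Z T) UNIV \<and>
     (\<forall>n\<ge>1. distr M (cycle_space S) (cycle Z T n) = distr M (cycle_space S) (cycle Z T 1))"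

text \<open>\<open>iterate f k x u\<close> is $f^{(k)}(x, u_1, \ldots, u_k)$, with the arguments
  $u_1, u_2, \ldots$ given as \<open>u 0, u 1, \<dots>\<close>\<close>

primrec iterate :: "(real \<Rightarrow> 'z \<Rightarrow> real) \<Rightarrow> nat \<Rightarrow> real \<Rightarrow> (nat \<Rightarrow> 'z) \<Rightarrow> real" where
  "iterate f 0 x u = x"
| "iterate f (Suc k) x u = f (iterate f k x u) (u k)"

primrec recursion ::
  "(real \<Rightarrow> 'z \<Rightarrow> real) \<Rightarrow> (nat \<Rightarrow> 'w \<Rightarrow> 'z) \<Rightarrow> real \<Rightarrow> nat \<Rightarrow> 'w \<Rightarrow> real" where
  "recursion f Z x 0 \<omega> = x"
| "recursion f Z x (Suc t) \<omega> = f (recursion f Z x t \<omega>) (Z t \<omega>)"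

text \<open>The process $\widetilde X^{(\alpha)}$: the same recursion, driven by the sequence from time
  $T_0$ on.\<close>

definition aux_process ::
  "(real \<Rightarrow> 'z \<Rightarrow> real) \<Rightarrow> (nat \<Rightarrow> 'w \<Rightarrow> 'z) \<Rightarrow> (nat \<Rightarrow> 'w \<Rightarrow> nat) \<Rightarrow> real \<Rightarrow> nat \<Rightarrow> 'w \<Rightarrow> real" where
  "aux_process f Z T \<alpha> = recursion f (\<lambda>t \<omega>. Z (T 0 \<omega> + t) \<omega>) \<alpha>"

text \<open>Distribution of $X_{T_n}$ if $X_{T_0} = x$, i.e. when the recursion is started from the
  value \<open>x\<close> at time $T_0$.\<close>

definition regen_distr ::
  "'w measure \<Rightarrow> (real \<Rightarrow> 'z \<Rightarrow> real) \<Rightarrow> (nat \<Rightarrow> 'w \<Rightarrow> 'z) \<Rightarrow> (nat \<Rightarrow> 'w \<Rightarrow> nat) \<Rightarrow> nat \<Rightarrow> real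
     \<Rightarrow> real measure" where
  "regen_distr M f Z T n x = distr M borel (\<lambda>\<omega>. aux_process f Z T x (T n \<omega> - T 0 \<omega>) \<omega>)"

definition uniform_dist :: "real measure \<Rightarrow> real measure \<Rightarrow> real" where
  "uniform_dist F G = (SUP r. \<bar>cdf F r - cdf G r\<bar>)"

definition distribution_on :: "real \<Rightarrow> real \<Rightarrow> real measure \<Rightarrow> bool" where
  "distribution_on a b F \<longleftrightarrow> real_distribution F \<and> measure F {a..b} = 1"

text \<open>\<open>stationary_prob M f Z T a b F E\<close> is
  \[ \frac{1}{\mathbf{E}\tau_1} \sum_{l \ge 0} \mathbf{P}\bigl(\tau_1 > l,\
       (f^{(l)}(\widetilde X_0^{(F)}, Z_{T_0}, \ldots, Z_{T_0+l-1}),\ Z_{T_0+l}) \in E\bigr). \]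
  The variable $\widetilde X_0^{(F)}$, with distribution \<open>F\<close> and independent of the
  regenerative sequence, is the first coordinate of the product space \<open>F \<Otimes>\<^sub>M M\<close>.
  The condition \<open>fst p \<in> {a..b}\<close> has probability one; it is there because \<open>f\<close> is
  constrained on \<open>{a..b}\<close> only, so that without it the event need not be measurable.\<close>

definition stationary_prob ::
  "'w measure \<Rightarrow> (real \<Rightarrow> 'z \<Rightarrow> real) \<Rightarrow> (nat \<Rightarrow> 'w \<Rightarrow> 'z) \<Rightarrow> (nat \<Rightarrow> 'w \<Rightarrow> nat)
     \<Rightarrow> real \<Rightarrow> real \<Rightarrow> real measure \<Rightarrow> (real \<times> 'z) set \<Rightarrow> real" where
  "stationary_prob M f Z T a b F E =
     1 / (\<integral>\<omega>. real (cycle_length T 1 \<omega>) \<partial>M) *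
     (\<Sum>l. \<P>(p in F \<Otimes>\<^sub>M M.
        fst p \<in> {a..b} \<and> cycle_length T 1 (snd p) > l \<and>
        (iterate f l (fst p) (\<lambda>s. Z (T 0 (snd p) + s) (snd p)),
         Z (T 0 (snd p) + l) (snd p)) \<in> E))"

end

theory Submission
  imports Defs
begin

text \<open>
  The proof reads the process cycle by cycle.  Let \<open>F y \<xi>\<close> be the value of the recursion at the
  end of a cycle \<open>\<xi>\<close> that it enters at \<open>y\<close> (\<open>cycle_map\<close>).  For each \<open>\<xi>\<close> this is an increasing
  function of \<open>y\<close>, and the cycles after \<open>T 0\<close> are independent with a common law \<open>Q\<close>.  Hence the
  values at the regeneration times form a Markov chain of iterated random monotone maps.

  One step of this chain sends a law \<open>\<nu>\<close> to the law of \<open>F y \<xi>\<close>, where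
  \<open>(y, \<xi>)\<close> has the law \<open>\<nu> \<Otimes> Q\<close>.  For fixed \<open>\<xi>\<close> the event \<open>F y \<xi> \<le> r\<close> is a down-closed set of
  \<open>y\<close>, and two laws differ on such a set by at most their Kolmogorov distance.  If \<open>r \<ge> c\<close> and
  \<open>F b \<xi> \<le> c\<close>, the set contains every \<open>y\<close>; if \<open>r < c\<close> and \<open>F a \<xi> \<ge> c\<close>, it contains none; in both
  cases the two laws agree on it.  So one step contracts the Kolmogorov metric by the factor
  \<open>1 - min \<epsilon>\<^sub>1 \<epsilon>\<^sub>2\<close> (\<open>step_contraction\<close>), and completeness of that metric yields \<open>\<pi>\<close> and the
  geometric rate (\<open>ex_limit_distribution\<close>).

  To reach a fixed time \<open>t\<close>, let \<open>T n \<le> t < T (n + 1)\<close> and restart the recursion \<open>m\<close> cycles earlier,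
  at the time \<open>T (n - m)\<close>, from the value \<open>a\<close> or from the value \<open>b\<close>.  By monotonicity the two restarted
  values at \<open>t\<close> enclose \<open>X\<^sub>t\<close>.  A restarted value depends only on cycles that are independent of
  \<open>T (n - m)\<close> and whose law does not depend on \<open>n\<close>; summing over \<open>n\<close>, its distribution becomes a
  convolution of the renewal probabilities \<open>u s = \<Sum>k. P (T k = s)\<close> with a sequence dominated by one
  summable sequence, the same for all the events in question (\<open>prob_restarted_event\<close>).  Since \<open>u s\<close>
  tends to \<open>1 / E \<tau>\<^sub>1\<close> by the renewal theorem (\<open>discrete_renewal_theorem\<close>), dominated convergence
  gives the limit uniformly in those events (\<open>prob_restarted_event_tendsto\<close>).  This limit is the
  stationary expression with \<open>\<pi>\<close> replaced by the law of the chain after \<open>m\<close> steps from \<open>a\<close> or \<open>b\<close>.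
  As the events are again down-closed in the initial value, the replacement changes it by at most
  the Kolmogorov distance, which tends to \<open>0\<close> as \<open>m\<close> grows (\<open>uniform_convergence\<close>).  The
  convergence of the laws of \<open>X\<^sub>t\<close> alone is the case \<open>A = space S\<close>.
\<close>

section \<open>The discrete renewal theorem\<close>

lemma dominated_convergence_suminf:
  fixes a :: "nat \<Rightarrow> nat \<Rightarrow> real"
  assumes "\<And>k. (\<lambda>n. a k n) \<longlonglongrightarrow> b k" and "\<And>k n. \<bar>a k n\<bar> \<le> M k" and "summable M"
  shows "(\<lambda>n. \<Sum>k. a k n) \<longlonglongrightarrow> (\<Sum>k. b k)"
  using tannerys_theorem[of a b sequentially M] assms by (auto intro!: always_eventually)

lemma convolution_suminf:
  fixes p q :: "nat \<Rightarrow> real"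
  shows "(\<Sum>i\<le>n. p i * q (n - i)) = (\<Sum>i. if i \<le> n then p i * q (n - i) else 0)"
  by (subst suminf_finite[of "{..n}"]) auto

lemma convolution_tendsto:
  fixes g q :: "nat \<Rightarrow> real"
  assumes g: "summable g" "\<And>k. 0 \<le> g k" and bound: "\<And>n. \<bar>q n\<bar> \<le> B"
    and \<sigma>: "filterlim \<sigma> at_top sequentially"
    and lim: "\<And>k. (\<lambda>j. q (\<sigma> j - k)) \<longlonglongrightarrow> l"
  shows "(\<lambda>j. \<Sum>k\<le>\<sigma> j. g k * q (\<sigma> j - k)) \<longlonglongrightarrow> (\<Sum>k. g k) * l"
proof -
  have "(\<lambda>j. \<Sum>k. if k \<le> \<sigma> j then g k * q (\<sigma> j - k) else 0) \<longlonglongrightarrow> (\<Sum>k. g k * l)"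
  proof (rule dominated_convergence_suminf[where M="\<lambda>k. g k * B"])
    fix k
    have "eventually (\<lambda>j. k \<le> \<sigma> j) sequentially"
      using \<sigma> by (simp add: filterlim_at_top)
    then have "eventually (\<lambda>j. g k * q (\<sigma> j - k) = (if k \<le> \<sigma> j then g k * q (\<sigma> j - k) else 0))
        sequentially"
      by eventually_elim simp
    moreover have "(\<lambda>j. g k * q (\<sigma> j - k)) \<longlonglongrightarrow> g k * l"
      by (intro tendsto_intros lim)
    ultimately show "(\<lambda>j. if k \<le> \<sigma> j then g k * q (\<sigma> j - k) else 0) \<longlonglongrightarrow> g k * l"
      by (rule Lim_transform_eventually[rotated])
  next
    fix k n
    have "0 \<le> B" using bound[of 0] by linarith
    then show "\<bar>if k \<le> \<sigma> n then g k * q (\<sigma> n - k) else 0\<bar> \<le> g k * B"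
      using g(2)[of k] bound[of "\<sigma> n - k"] by (auto simp: abs_mult intro!: mult_left_mono)
  qed (use g in \<open>auto intro: summable_mult2\<close>)
  then show ?thesis
    by (simp add: convolution_suminf suminf_mult2[OF g(1)])
qed

text \<open>The limit superior, in the form in which the renewal argument uses it: it is attained along
  \<open>\<sigma>\<close>, and the excess over it vanishes along the whole sequence.\<close>

lemma ex_limsup_subseq:
  fixes v :: "nat \<Rightarrow> real"
  assumes bound: "\<And>n. \<bar>v n\<bar> \<le> 1"
  obtains l \<sigma> where "filterlim \<sigma> at_top sequentially" "(\<lambda>j. v (\<sigma> j)) \<longlonglongrightarrow> l"
    "(\<lambda>n. max 0 (v n - l)) \<longlonglongrightarrow> 0"
proof -
  let ?L = "limsup (\<lambda>n. ereal (v n))"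
  obtain \<sigma> where \<sigma>: "strict_mono \<sigma>" "((\<lambda>n. ereal (v n)) \<circ> \<sigma>) \<longlonglongrightarrow> ?L"
    using limsup_subseq_lim by blast
  have "?L \<le> 1" 
    by (rule LIMSEQ_le_const2[OF \<sigma>(2)]) (use bound in \<open>auto simp: abs_le_iff\<close>)
  moreover have "-1 \<le> ?L"
    by (rule LIMSEQ_le_const[OF \<sigma>(2)]) (use bound in \<open>auto simp: abs_le_iff minus_le_iff one_ereal_def\<close>)
  ultimately obtain l where l: "?L = ereal l"
    by (cases ?L) auto
  have "(\<lambda>n. max 0 (v n - l)) \<longlonglongrightarrow> 0"
  proof (rule order_tendstoI)
    fix c :: real assume "0 < c"
    then have "?L < ereal (l + c)" by (simp add: l)
    then have "eventually (\<lambda>n. ereal (v n) < ereal (l + c)) sequentially"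
      by (rule Limsup_lessD)
    then show "eventually (\<lambda>n. max 0 (v n - l) < c) sequentially"
      by eventually_elim (use \<open>0 < c\<close> in auto)
  qed (auto simp: less_max_iff_disj)
  moreover have "filterlim \<sigma> at_top sequentially"
    using \<sigma>(1) by (rule filterlim_subseq)
  moreover have "(\<lambda>j. v (\<sigma> j)) \<longlonglongrightarrow> l"
    using \<sigma>(2) by (simp add: l comp_def)
  ultimately show ?thesis using that by blast
qed

text \<open>The least positive difference of two elements divides every element, for otherwise a remainder
  would be a smaller difference; so it is \<open>1\<close>.  Once \<open>x\<close> and \<open>x + 1\<close> both belong to \<open>A\<close>, every
  \<open>n \<ge> x * x\<close> is a combination of them.\<close>

lemma Gcd_1_semigroup:
  fixes A :: "nat set"
  assumes zero: "0 \<in> A" and add: "\<And>x y. x \<in> A \<Longrightarrow> y \<in> A \<Longrightarrow> x + y \<in> A" and Gcd: "Gcd A = 1"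
  shows "\<exists>N. \<forall>n\<ge>N. n \<in> A"
proof -
  have mult: "k * x \<in> A" if "x \<in> A" for k x
    by (induction k) (use that zero add in auto)
  define D where "D d \<longleftrightarrow> 0 < d \<and> (\<exists>x\<in>A. x + d \<in> A)" for d
  have "\<exists>x\<in>A. x \<noteq> 0"
  proof (rule ccontr)
    assume "\<not> ?thesis"
    then have "A \<subseteq> {0}" by auto
    then have "Gcd A = 0" by simp
    with Gcd show False by simp
  qed
  then have "\<exists>d. D d" using zero unfolding D_def by force
  define d where "d = (LEAST d. D d)"
  have "D d" unfolding d_def using \<open>\<exists>d. D d\<close> by (rule LeastI_ex)
  then obtain x where x: "x \<in> A" "x + d \<in> A" and "0 < d" unfolding D_def by blast
  have "d dvd n" if "n \<in> A" for n
  proof (rule ccontr)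
    assume "\<not> d dvd n"
    then have pos: "0 < n mod d" by (simp add: mod_greater_zero_iff_not_dvd)
    let ?k = "n div d"
    \<comment> \<open>\<open>n mod d\<close> is the difference of \<open>n + k * x\<close> and \<open>k * (x + d)\<close>, where \<open>k = n div d\<close>.\<close>
    have "n + ?k * x \<in> A" "?k * (x + d) \<in> A"
      using that x by (auto intro: add mult)
    moreover have "n + ?k * x = ?k * (x + d) + n mod d"
      by (metis add.assoc add.commute distrib_left div_mult_mod_eq)
    ultimately have "D (n mod d)" unfolding D_def using pos by auto
    then have "d \<le> n mod d" unfolding d_def by (rule Least_le)
    with \<open>0 < d\<close> show False by (metis leD mod_less_divisor)
  qed
  then have "d dvd Gcd A" by (rule Gcd_greatest)
  then have "x + 1 \<in> A" using x Gcd by simp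
  have "n \<in> A" if "n \<ge> x * x" for n
  proof (cases "x = 0")
    case True
    then show ?thesis using mult[OF \<open>x + 1 \<in> A\<close>, of n] by simp
  next
    case False
    then have "n mod x < x" "x \<le> n div x"
      using that by (simp_all add: less_eq_div_iff_mult_less_eq)
    then obtain e where "n div x = n mod x + e" using le_Suc_ex by (meson less_imp_le order.trans)
    then have "n = (n mod x + e) * x + n mod x" by (metis div_mult_mod_eq)
    then have "n = e * x + (n mod x) * (x + 1)" by (simp add: algebra_simps)
    then have "\<exists>i j. n = i * x + j * (x + 1)" by blast
    then show ?thesis using add mult x(1) \<open>x + 1 \<in> A\<close> by blast
  qed
  then show ?thesis by blast
qed

text \<open>Up to vanishing terms, \<open>v n\<close> is an average of earlier values with the weights \<open>p\<close>, and no value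
  much exceeds the limit superior \<open>l\<close>.  If the average comes close to \<open>l\<close>, each value that enters it
  with a positive weight has to come close to \<open>l\<close> as well.\<close>

lemma renewal_maximum_principle:
  fixes p v e :: "nat \<Rightarrow> real"
  assumes p: "\<And>n. 0 \<le> p n" "p sums 1" and bound: "\<And>n. \<bar>v n\<bar> \<le> 1"
    and rec: "\<And>n. v n = e n + (\<Sum>i\<le>n. p i * v (n - i))" and e: "e \<longlonglongrightarrow> 0"
    and \<sigma>: "filterlim \<sigma> at_top sequentially" and lim: "(\<lambda>j. v (\<sigma> j)) \<longlonglongrightarrow> l"
    and top: "(\<lambda>n. max 0 (v n - l)) \<longlonglongrightarrow> 0" and k: "0 < p k"
  shows "(\<lambda>j. v (\<sigma> j - k)) \<longlonglongrightarrow> l"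
proof -
  let ?w = "\<lambda>n. max 0 (v n - l)"
  let ?c = "\<lambda>n. \<Sum>i\<le>n. p i * ?w (n - i)"
  \<comment> \<open>\<open>l + ?s n\<close> bounds \<open>v (n - k)\<close> from below: solve the recurrence for the term with index \<open>k\<close>
    and estimate every other value \<open>v (n - i)\<close> by \<open>l + ?w (n - i)\<close>.\<close>
  let ?s = "\<lambda>n. (v n - e n - ?c n - l * (\<Sum>i\<le>n. p i)) / p k"
  have shift: "filterlim (\<lambda>j. \<sigma> j - i) at_top sequentially" for i
    by (rule filterlim_compose[OF filterlim_minus_const_nat_at_top \<sigma>])
  have "(\<lambda>j. ?c (\<sigma> j)) \<longlonglongrightarrow> (\<Sum>k. p k) * 0"
  proof (rule convolution_tendsto[OF _ p(1) _ \<sigma>])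
    show "summable p" using p(2) by (rule sums_summable)
    show "\<bar>?w n\<bar> \<le> 1 + \<bar>l\<bar>" for n using bound[of n] by auto
    show "(\<lambda>j. ?w (\<sigma> j - i)) \<longlonglongrightarrow> 0" for i by (rule filterlim_compose[OF top shift])
  qed
  then have c: "(\<lambda>j. ?c (\<sigma> j)) \<longlonglongrightarrow> 0" by simp
  have P: "(\<lambda>j. \<Sum>i\<le>\<sigma> j. p i) \<longlonglongrightarrow> 1"
    by (rule filterlim_compose[OF _ \<sigma>]) (use p(2) in \<open>simp add: sums_def_le\<close>)
  have "(\<lambda>j. ?s (\<sigma> j)) \<longlonglongrightarrow> (l - 0 - 0 - l * 1) / p k"
    using k by (intro tendsto_intros lim c P filterlim_compose[OF e \<sigma>]) auto
  then have "(\<lambda>j. l + ?s (\<sigma> j)) \<longlonglongrightarrow> l + 0"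
    by (intro tendsto_intros) simp
  moreover have "(\<lambda>j. l + ?w (\<sigma> j - k)) \<longlonglongrightarrow> l + 0"
    by (intro tendsto_intros filterlim_compose[OF top shift])
  moreover have "eventually (\<lambda>j. l + ?s (\<sigma> j) \<le> v (\<sigma> j - k)) sequentially"
  proof -
    have "l + ?s n \<le> v (n - k)" if "k \<le> n" for n
    proof -
      have split: "(\<Sum>i\<le>n. g i) = g k + (\<Sum>i\<in>{..n} - {k}. g i)" for g :: "nat \<Rightarrow> real"
        using that by (intro sum.remove) auto
      have "(\<Sum>i\<in>{..n} - {k}. p i * v (n - i)) \<le> (\<Sum>i\<in>{..n} - {k}. p i * l + p i * ?w (n - i))"
        by (intro sum_mono) (use p(1) in \<open>auto simp flip: distrib_left intro!: mult_left_mono\<close>)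
      also have "\<dots> \<le> l * ((\<Sum>i\<le>n. p i) - p k) + ?c n"
        unfolding split[of p] split[of "\<lambda>i. p i * ?w (n - i)"]
        using p(1)[of k] by (simp add: sum.distrib sum_distrib_left mult.commute)
      finally have "v n \<le> e n + p k * v (n - k) + (l * ((\<Sum>i\<le>n. p i) - p k) + ?c n)"
        using rec[of n] by (simp add: split[of "\<lambda>i. p i * v (n - i)"])
      then show ?thesis using k by (simp add: field_simps)
    qed
    moreover have "eventually (\<lambda>j. k \<le> \<sigma> j) sequentially" using \<sigma> by (simp add: filterlim_at_top)
    ultimately show ?thesis by (auto elim: eventually_mono)
  qed
  moreover have "eventually (\<lambda>j. v (\<sigma> j - k) \<le> l + ?w (\<sigma> j - k)) sequentially"
    by (intro always_eventually) auto
  ultimately show ?thesis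
    using tendsto_sandwich[of "\<lambda>j. l + ?s (\<sigma> j)" "\<lambda>j. v (\<sigma> j - k)" sequentially
        "\<lambda>j. l + ?w (\<sigma> j - k)" l] by simp
qed

text \<open>Iterating the maximum principle, the shifts under which convergence to \<open>l\<close> persists form a
  semigroup that contains the support of \<open>p\<close>; by aperiodicity it contains all large numbers.
  Far enough back from \<open>\<sigma> j\<close> the sequence is therefore asymptotically constant.\<close>

lemma renewal_constant_window:
  fixes p v e :: "nat \<Rightarrow> real"
  assumes p: "\<And>n. 0 \<le> p n" "p sums 1" and Gcd: "Gcd {n. 0 < p n} = 1"
    and bound: "\<And>n. \<bar>v n\<bar> \<le> 1"
    and rec: "\<And>n. v n = e n + (\<Sum>i\<le>n. p i * v (n - i))" and e: "e \<longlonglongrightarrow> 0"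
  obtains l \<sigma> where "filterlim \<sigma> at_top sequentially" "\<And>k. (\<lambda>j. v (\<sigma> j - k)) \<longlonglongrightarrow> l"
    "(\<lambda>n. max 0 (v n - l)) \<longlonglongrightarrow> 0"
proof -
  obtain l \<sigma> where \<sigma>: "filterlim \<sigma> at_top sequentially" "(\<lambda>j. v (\<sigma> j)) \<longlonglongrightarrow> l"
    and top: "(\<lambda>n. max 0 (v n - l)) \<longlonglongrightarrow> 0"
    by (rule ex_limsup_subseq[OF bound])
  define A where "A = {k. \<forall>\<sigma>. filterlim \<sigma> at_top sequentially \<longrightarrow>
    (\<lambda>j. v (\<sigma> j)) \<longlonglongrightarrow> l \<longrightarrow> (\<lambda>j. v (\<sigma> j - k)) \<longlonglongrightarrow> l}"
  have shift: "filterlim (\<lambda>j. \<sigma> j - i) at_top sequentially"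
    if "filterlim \<sigma> at_top sequentially" for \<sigma> :: "nat \<Rightarrow> nat" and i
    by (rule filterlim_compose[OF filterlim_minus_const_nat_at_top that])
  have "\<exists>N. \<forall>n\<ge>N. n \<in> A"
  proof (rule Gcd_1_semigroup)
    show "0 \<in> A" by (simp add: A_def)
    show "x + y \<in> A" if x: "x \<in> A" and y: "y \<in> A" for x y
      unfolding A_def
    proof (intro CollectI allI impI)
      fix \<sigma> :: "nat \<Rightarrow> nat"
      assume s: "filterlim \<sigma> at_top sequentially" and "(\<lambda>j. v (\<sigma> j)) \<longlonglongrightarrow> l"
      then have "(\<lambda>j. v (\<sigma> j - x)) \<longlonglongrightarrow> l" using x by (auto simp: A_def)
      then have "(\<lambda>j. v (\<sigma> j - x - y)) \<longlonglongrightarrow> l"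
        using y shift[OF s, of x] unfolding A_def by (auto dest!: spec[of _ "\<lambda>j. \<sigma> j - x"])
      then show "(\<lambda>j. v (\<sigma> j - (x + y))) \<longlonglongrightarrow> l" by simp
    qed
    have "{n. 0 < p n} \<subseteq> A"
      using renewal_maximum_principle[OF p bound rec e _ _ top] by (auto simp: A_def)
    then have "Gcd A dvd Gcd {n. 0 < p n}" by (intro Gcd_greatest Gcd_dvd) auto
    then show "Gcd A = 1" using Gcd by simp
  qed
  then obtain N where N: "\<And>n. N \<le> n \<Longrightarrow> n \<in> A" by blast
  have "(\<lambda>j. v (\<sigma> j - N - k)) \<longlonglongrightarrow> l" for k
    using N[of "N + k"] \<sigma> by (auto simp: A_def)
  with shift[OF \<sigma>(1), of N] top that[of "\<lambda>j. \<sigma> j - N" l] show ?thesis by blast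
qed

text \<open>The weights \<open>1 - (\<Sum>i\<le>k. p i)\<close> are the tails of \<open>p\<close>.  In probabilistic terms, the renewal
  cycle that contains \<open>n\<close> has started at some \<open>n - k\<close> and lasts longer than \<open>k\<close>; the right-hand
  side is the probability that the delay is over at time \<open>n\<close>.\<close>

lemma renewal_identity:
  fixes p d u :: "nat \<Rightarrow> real"
  assumes "p 0 = 0" and rec: "\<And>n. u n = d n + (\<Sum>i\<le>n. p i * u (n - i))"
  shows "(\<Sum>k\<le>n. (1 - (\<Sum>i\<le>k. p i)) * u (n - k)) = (\<Sum>k\<le>n. d k)"
proof (induction n)
  case 0
  then show ?case using rec[of 0] \<open>p 0 = 0\<close> by simp
next
  case (Suc n)
  let ?r = "\<lambda>k. 1 - (\<Sum>i\<le>k. p i)"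
  have "(\<Sum>k\<le>Suc n. ?r k * u (Suc n - k)) = u (Suc n) + (\<Sum>k\<le>n. ?r (Suc k) * u (n - k))"
    using \<open>p 0 = 0\<close> by (simp only: sum.atMost_Suc_shift) simp
  also have "(\<Sum>k\<le>n. ?r (Suc k) * u (n - k))
      = (\<Sum>k\<le>n. ?r k * u (n - k)) - (\<Sum>k\<le>n. p (Suc k) * u (n - k))"
    by (simp add: algebra_simps flip: sum_subtractf)
  also have "(\<Sum>k\<le>n. p (Suc k) * u (n - k)) = (\<Sum>i\<le>Suc n. p i * u (Suc n - i))"
    using \<open>p 0 = 0\<close> by (simp only: sum.atMost_Suc_shift) simp
  also have "u (Suc n) + ((\<Sum>k\<le>n. ?r k * u (n - k)) - (\<Sum>i\<le>Suc n. p i * u (Suc n - i)))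
      = d (Suc n) + (\<Sum>k\<le>n. d k)"
    using rec[of "Suc n"] Suc.IH by linarith
  finally show ?case by simp
qed

text \<open>The argument of Erdos, Feller and Pollard, for a delayed renewal sequence.  Along a stretch on
  which \<open>u\<close> is asymptotically equal to its limit superior \<open>l\<close>, the identity of the previous lemma
  becomes \<open>l * \<mu> = 1\<close> in the limit.  Applied to \<open>- u\<close>, the same reasoning gives the limit inferior.\<close>

theorem discrete_renewal_theorem:
  fixes p d u :: "nat \<Rightarrow> real"
  assumes p: "\<And>n. 0 \<le> p n" "p sums 1" "p 0 = 0" and Gcd: "Gcd {n. 0 < p n} = 1"
    and mean: "(\<lambda>k. 1 - (\<Sum>i\<le>k. p i)) sums \<mu>"
    and d: "\<And>n. 0 \<le> d n" "d sums 1" and u: "\<And>n. 0 \<le> u n"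
    and rec: "\<And>n. u n = d n + (\<Sum>i\<le>n. p i * u (n - i))"
  shows "u \<longlonglongrightarrow> 1 / \<mu>" and "\<And>n. u n \<le> 1"
proof -
  let ?r = "\<lambda>k. 1 - (\<Sum>i\<le>k. p i)"
  have r: "0 \<le> ?r k" for k
    using sum_le_suminf[of p "{..k}"] p sums_unique[OF p(2)] sums_summable[OF p(2)] by simp
  note id = renewal_identity[OF p(3) rec]
  have D: "(\<Sum>k\<le>n. d k) \<le> 1" for n
    using sum_le_suminf[of d "{..n}"] d sums_unique[OF d(2)] sums_summable[OF d(2)] by simp
  show le1: "u n \<le> 1" for n
  proof -
    have "?r 0 * u (n - 0) \<le> (\<Sum>k\<le>n. ?r k * u (n - k))"
      by (rule member_le_sum[where f="\<lambda>k. ?r k * u (n - k)"]) (use r u in auto)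
    then show ?thesis using id[of n] D[of n] p(3) by simp
  qed
  have d0: "d \<longlonglongrightarrow> 0" using d(2) by (intro summable_LIMSEQ_zero) (rule sums_summable)
  \<comment> \<open>The sign \<open>s\<close> treats \<open>u\<close> and \<open>- u\<close> together.\<close>
  have unit: "l * \<mu> = s" if \<sigma>: "filterlim \<sigma> at_top sequentially"
    and lim: "\<And>k. (\<lambda>j. s * u (\<sigma> j - k)) \<longlonglongrightarrow> l" for l s \<sigma>
  proof (rule LIMSEQ_unique)
    have "(\<lambda>j. \<Sum>k\<le>\<sigma> j. ?r k * (s * u (\<sigma> j - k))) \<longlonglongrightarrow> (\<Sum>k. ?r k) * l"
    proof (rule convolution_tendsto[OF _ r _ \<sigma> lim])
      show "summable ?r" using mean by (rule sums_summable)
      show "\<bar>s * u n\<bar> \<le> \<bar>s\<bar>" for n using u[of n] le1[of n] by (simp add: abs_mult mult_left_le)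
    qed
    then have "(\<lambda>j. s * (\<Sum>k\<le>\<sigma> j. ?r k * u (\<sigma> j - k))) \<longlonglongrightarrow> (\<Sum>k. ?r k) * l"
      by (simp add: sum_distrib_left mult.left_commute)
    then show "(\<lambda>j. s * (\<Sum>k\<le>\<sigma> j. d k)) \<longlonglongrightarrow> l * \<mu>"
      unfolding id using sums_unique[OF mean] by (simp add: mult.commute)
    have "(\<lambda>j. \<Sum>k\<le>\<sigma> j. d k) \<longlonglongrightarrow> 1"
      by (rule filterlim_compose[OF _ \<sigma>]) (use d(2) in \<open>simp add: sums_def_le\<close>)
    then show "(\<lambda>j. s * (\<Sum>k\<le>\<sigma> j. d k)) \<longlonglongrightarrow> s"
      by (auto intro: tendsto_eq_intros)
  qed
  have half: "\<exists>l. l * \<mu> = s \<and> (\<lambda>n. max 0 (s * u n - l)) \<longlonglongrightarrow> 0" if s: "s = 1 \<or> s = -1" for s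
  proof -
    have "s * u n = s * d n + (\<Sum>i\<le>n. p i * (s * u (n - i)))" for n
      by (subst rec) (simp add: algebra_simps sum_distrib_left)
    moreover have "(\<lambda>n. s * d n) \<longlonglongrightarrow> 0" using tendsto_mult[OF tendsto_const d0, of s] by simp
    moreover have "\<bar>s * u n\<bar> \<le> 1" for n using s u[of n] le1[of n] by auto
    ultimately show ?thesis
      using renewal_constant_window[OF p(1,2) Gcd, of "\<lambda>n. s * u n" "\<lambda>n. s * d n"] unit
      by metis
  qed
  obtain l1 where l1: "l1 * \<mu> = 1" "(\<lambda>n. max 0 (u n - l1)) \<longlonglongrightarrow> 0"
    using half[of 1] by auto
  obtain l2 where l2: "l2 * \<mu> = -1" "(\<lambda>n. max 0 (- u n - l2)) \<longlonglongrightarrow> 0"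
    using half[of "-1"] by auto
  have "\<mu> \<noteq> 0" using l1 by auto
  then have l: "l1 = 1 / \<mu>" "l2 = - (1 / \<mu>)" using l1 l2 by (auto simp: field_simps)
  have "(\<lambda>n. max 0 (u n - l1) - max 0 (- u n - l2) + 1 / \<mu>) \<longlonglongrightarrow> 0 - 0 + 1 / \<mu>"
    by (intro tendsto_intros l1 l2)
  moreover have "max 0 (u n - l1) - max 0 (- u n - l2) + 1 / \<mu> = u n" for n
    unfolding l by (auto simp: max_def)
  ultimately show "u \<longlonglongrightarrow> 1 / \<mu>" by simp
qed

section \<open>Measurability on the space of cycles\<close>

lemma listset_iff: "xs \<in> listset As \<longleftrightarrow> list_all2 (\<in>) xs As"
  by (induction As arbitrary: xs) (auto simp: set_Cons_def list_all2_Cons2)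

lemma listset_subset_lists: "set As \<subseteq> sets S \<Longrightarrow> listset As \<subseteq> lists (space S)"
proof (intro subsetI in_listsI ballI)
  fix xs x assume As: "set As \<subseteq> sets S" and xs: "xs \<in> listset As" and "x \<in> set xs"
  then obtain i where i: "i < length As" "x = xs ! i" "xs ! i \<in> As ! i"
    by (auto simp: listset_iff list_all2_conv_all_nth in_set_conv_nth)
  then have "As ! i \<in> sets S" using As nth_mem by blast
  then show "x \<in> space S" using i sets.sets_into_space by blast
qed

lemma space_cycle_space [simp]: "space (cycle_space S) = lists (space S)"
  unfolding cycle_space_def using listset_subset_lists by (intro space_measure_of) blast

lemma sets_cycle_space_rectangle: "set As \<subseteq> sets S \<Longrightarrow> listset As \<in> sets (cycle_space S)"
  unfolding cycle_space_def
  by (intro in_measure_of) (use listset_subset_lists in blast)+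

lemma sets_cycle_space_length: "{xs \<in> lists (space S). length xs = n} \<in> sets (cycle_space S)"
proof -
  have "{xs \<in> lists (space S). length xs = n} = listset (replicate n (space S))"
    by (auto simp: listset_iff list_all2_conv_all_nth) (auto simp: in_set_conv_nth)
  also have "\<dots> \<in> sets (cycle_space S)"
    by (rule sets_cycle_space_rectangle) auto
  finally show ?thesis .
qed

lemma measurable_length_cycle [measurable]: "length \<in> cycle_space S \<rightarrow>\<^sub>M count_space UNIV"
proof (rule measurable_count_space_eq2_countable[THEN iffD2], safe)
  fix n
  have "length -` {n} \<inter> space (cycle_space S) = {xs \<in> lists (space S). length xs = n}"
    by auto
  then show "length -` {n} \<inter> space (cycle_space S) \<in> sets (cycle_space S)"
    using sets_cycle_space_length[of S n] by simp
qed auto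

text \<open>A measurable coordinate has to be defined on lists of every length, so the entries beyond the
  end are filled with a fixed element of the state space.\<close>

definition nth_or :: "'z \<Rightarrow> 'z list \<Rightarrow> nat \<Rightarrow> 'z" where
  "nth_or z0 xs i = (if i < length xs then xs ! i else z0)"

lemma nth_or_in_space: "z0 \<in> space S \<Longrightarrow> xs \<in> lists (space S) \<Longrightarrow> nth_or z0 xs i \<in> space S"
  by (auto simp: nth_or_def)

text \<open>Among the lists of a given length \<open>n\<close>, a condition on entry \<open>i < n\<close> is one of the generating
  rectangles; for \<open>i \<ge> n\<close> the entry is constant.\<close>

lemma measurable_nth_or:
  assumes z0: "z0 \<in> space S"
  shows "(\<lambda>xs. nth_or z0 xs i) \<in> cycle_space S \<rightarrow>\<^sub>M S"
proof (rule measurableI)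
  fix A assume A: "A \<in> sets S"
  have "{xs \<in> lists (space S). length xs = n \<and> nth_or z0 xs i \<in> A} \<in> sets (cycle_space S)" for n
  proof (cases "i < n")
    case True
    have "{xs \<in> lists (space S). length xs = n \<and> nth_or z0 xs i \<in> A}
        = listset ((replicate n (space S))[i := A])"
    proof (intro equalityI subsetI)
      fix xs assume "xs \<in> {xs \<in> lists (space S). length xs = n \<and> nth_or z0 xs i \<in> A}"
      then show "xs \<in> listset ((replicate n (space S))[i := A])"
        using True by (auto simp: listset_iff list_all2_conv_all_nth nth_or_def nth_list_update)
    next
      fix xs assume "xs \<in> listset ((replicate n (space S))[i := A])"
      then have xs: "length xs = n" "\<And>j. j < n \<Longrightarrow> xs ! j \<in> (if j = i then A else space S)"
        using True by (auto simp: listset_iff list_all2_conv_all_nth nth_list_update)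
      then have "xs ! j \<in> space S" if "j < n" for j
        using xs(2)[OF that] sets.sets_into_space[OF A] by (auto split: if_splits)
      then show "xs \<in> {xs \<in> lists (space S). length xs = n \<and> nth_or z0 xs i \<in> A}"
        using xs(1) xs(2)[OF True] True by (auto simp: in_set_conv_nth nth_or_def)
    qed
    moreover have "set ((replicate n (space S))[i := A]) \<subseteq> sets S"
      using set_update_subset_insert[of "replicate n (space S)" i A] A by force
    ultimately show ?thesis using sets_cycle_space_rectangle by metis
  next
    case False
    then have "{xs \<in> lists (space S). length xs = n \<and> nth_or z0 xs i \<in> A}
        = (if z0 \<in> A then {xs \<in> lists (space S). length xs = n} else {})"
      by (auto simp: nth_or_def)
    then show ?thesis using sets_cycle_space_length[of S n] by simp
  qed
  then have "(\<Union>n. {xs \<in> lists (space S). length xs = n \<and> nth_or z0 xs i \<in> A}) \<in> sets (cycle_space S)"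
    by blast
  also have "(\<Union>n. {xs \<in> lists (space S). length xs = n \<and> nth_or z0 xs i \<in> A})
      = (\<lambda>xs. nth_or z0 xs i) -` A \<inter> space (cycle_space S)"
    by auto
  finally show "(\<lambda>xs. nth_or z0 xs i) -` A \<inter> space (cycle_space S) \<in> sets (cycle_space S)" .
qed (use nth_or_in_space[OF z0] in auto)

section \<open>The Kolmogorov metric and down-closed sets\<close>

lemma down_closed_real_cases:
  fixes D :: "real set"
  assumes down: "\<And>x y. y \<in> D \<Longrightarrow> x \<le> y \<Longrightarrow> x \<in> D"
  obtains "D = {}" | "D = UNIV" | s where "D = {..s}" | s where "D = {..<s}"
proof -
  consider "D = {}" | "D \<noteq> {}" "\<not> bdd_above D" | "D \<noteq> {}" "bdd_above D" by metis
  then show thesis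
  proof cases
    case 2
    have "x \<in> D" for x
    proof -
      obtain y where "y \<in> D" "x < y" using 2 by (auto simp: bdd_above_def not_le)
      then show ?thesis using down[of y x] by simp
    qed
    then have "D = UNIV" by auto
    then show thesis by (rule that)
  next
    case 3
    show thesis
    proof (cases "Sup D \<in> D")
      case True
      then have "D = {..Sup D}" using 3 down[of "Sup D"] by (auto intro: cSup_upper)
      then show thesis by (rule that)
    next
      case False
      have "D = {..<Sup D}"
      proof (intro equalityI subsetI)
        fix x assume "x \<in> D"
        with False show "x \<in> {..<Sup D}" using cSup_upper[of x D] 3 by (auto simp: less_le)
      next
        fix x assume "x \<in> {..<Sup D}"
        then obtain y where "y \<in> D" "x < y" using less_cSup_iff[OF 3] by auto
        then show "x \<in> D" using down[of y x] by auto
      qed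
      then show thesis by (rule that)
    qed
  qed (use that in auto)
qed

text \<open>Besides the closed half-lines of the definition of the metric, only open half-lines occur; on
  these the measures are left limits of the distribution functions.\<close>

lemma down_closed_measure_diff:
  assumes "real_distribution \<nu>" "real_distribution \<nu>'"
    and \<delta>: "\<And>r. \<bar>cdf \<nu> r - cdf \<nu>' r\<bar> \<le> \<delta>"
    and down: "\<And>x y. y \<in> D \<Longrightarrow> x \<le> y \<Longrightarrow> x \<in> D"
  shows "\<bar>measure \<nu> D - measure \<nu>' D\<bar> \<le> \<delta>"
proof -
  interpret \<nu>: real_distribution \<nu> by fact
  interpret \<nu>': real_distribution \<nu>' by fact
  have "0 \<le> \<delta>" using \<delta>[of 0] by linarith
  show ?thesis
  proof (rule down_closed_real_cases[of D])
    show "x \<in> D" if "y \<in> D" "x \<le> y" for x y using down that .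
  next
    assume "D = {}" then show ?thesis using \<open>0 \<le> \<delta>\<close> by simp
  next
    assume "D = UNIV"
    then show ?thesis using \<open>0 \<le> \<delta>\<close> \<nu>.prob_space \<nu>'.prob_space by simp
  next
    fix s assume "D = {..s}" then show ?thesis using \<delta>[of s] by (simp add: cdf_def)
  next
    fix s assume D: "D = {..<s}"
    have "((\<lambda>r. \<bar>cdf \<nu> r - cdf \<nu>' r\<bar>) \<longlongrightarrow> \<bar>measure \<nu> {..<s} - measure \<nu>' {..<s}\<bar>) (at_left s)"
      by (intro tendsto_intros \<nu>.cdf_at_left \<nu>'.cdf_at_left)
    then show ?thesis
      unfolding D by (rule tendsto_upperbound) (use \<delta> in auto)
  qed
qed

lemma measure_pair_sections:
  assumes "prob_space \<nu>" "prob_space Q" and H: "H \<in> sets (\<nu> \<Otimes>\<^sub>M Q)"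
  shows "measure (\<nu> \<Otimes>\<^sub>M Q) H = (\<integral>\<xi>. measure \<nu> ((\<lambda>y. (y, \<xi>)) -` H) \<partial>Q)"
    and "integrable Q (\<lambda>\<xi>. measure \<nu> ((\<lambda>y. (y, \<xi>)) -` H))"
proof -
  interpret \<nu>: prob_space \<nu> by fact
  interpret Q: prob_space Q by fact
  interpret pair_prob_space \<nu> Q ..
  have m: "(\<lambda>\<xi>. measure \<nu> ((\<lambda>y. (y, \<xi>)) -` H)) \<in> borel_measurable Q"
    using measurable_emeasure_Pair2[OF H] unfolding measure_def by measurable
  have "emeasure (\<nu> \<Otimes>\<^sub>M Q) H = (\<integral>\<^sup>+\<xi>. ennreal (measure \<nu> ((\<lambda>y. (y, \<xi>)) -` H)) \<partial>Q)"
    by (simp add: emeasure_pair_measure_alt2[OF H] \<nu>.emeasure_eq_measure)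
  then show "measure (\<nu> \<Otimes>\<^sub>M Q) H = (\<integral>\<xi>. measure \<nu> ((\<lambda>y. (y, \<xi>)) -` H) \<partial>Q)"
    using m by (subst integral_eq_nn_integral) (auto simp: measure_def)
  show "integrable Q (\<lambda>\<xi>. measure \<nu> ((\<lambda>y. (y, \<xi>)) -` H))"
    by (rule Q.integrable_const_bound[where B=1]) (use m in auto)
qed

text \<open>Integrating the previous estimate over the second coordinate.  The factor \<open>measure Q E\<close>, which
  is what makes the embedded chain a contraction, appears because two probability measures agree
  on a section that is empty or the whole line.\<close>

lemma product_down_closed_measure_diff:
  assumes \<nu>: "real_distribution \<nu>" and \<nu>': "real_distribution \<nu>'" and Q: "prob_space Q"
    and \<delta>: "\<And>r. \<bar>cdf \<nu> r - cdf \<nu>' r\<bar> \<le> \<delta>"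
    and H: "H \<in> sets (borel \<Otimes>\<^sub>M Q)" and E: "E \<in> sets Q"
    and down: "\<And>\<xi> x y. \<xi> \<in> space Q \<Longrightarrow> (y, \<xi>) \<in> H \<Longrightarrow> x \<le> y \<Longrightarrow> (x, \<xi>) \<in> H"
    and triv: "\<And>\<xi>. \<xi> \<in> space Q \<Longrightarrow> \<xi> \<notin> E \<Longrightarrow> (\<forall>y. (y, \<xi>) \<in> H) \<or> (\<forall>y. (y, \<xi>) \<notin> H)"
  shows "\<bar>measure (\<nu> \<Otimes>\<^sub>M Q) H - measure (\<nu>' \<Otimes>\<^sub>M Q) H\<bar> \<le> \<delta> * measure Q E"
proof -
  interpret \<nu>: real_distribution \<nu> by fact
  interpret \<nu>': real_distribution \<nu>' by fact
  interpret Q: prob_space Q by fact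
  let ?g = "\<lambda>\<nu> \<xi>. measure \<nu> ((\<lambda>y. (y, \<xi>)) -` H)"
  have "H \<in> sets (\<nu> \<Otimes>\<^sub>M Q)" "H \<in> sets (\<nu>' \<Otimes>\<^sub>M Q)"
    using H by (simp_all cong: sets_pair_measure_cong)
  note s = measure_pair_sections[OF \<nu>.prob_space_axioms Q this(1)]
    measure_pair_sections[OF \<nu>'.prob_space_axioms Q this(2)]
  have "\<bar>measure (\<nu> \<Otimes>\<^sub>M Q) H - measure (\<nu>' \<Otimes>\<^sub>M Q) H\<bar> = \<bar>\<integral>\<xi>. ?g \<nu> \<xi> - ?g \<nu>' \<xi> \<partial>Q\<bar>"
    using s by simp
  also have "\<dots> \<le> (\<integral>\<xi>. \<bar>?g \<nu> \<xi> - ?g \<nu>' \<xi>\<bar> \<partial>Q)"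
    by (rule integral_abs_bound)
  also have "\<dots> \<le> (\<integral>\<xi>. \<delta> * indicator E \<xi> \<partial>Q)"
  proof (rule integral_mono)
    fix \<xi> assume \<xi>: "\<xi> \<in> space Q"
    show "\<bar>?g \<nu> \<xi> - ?g \<nu>' \<xi>\<bar> \<le> \<delta> * indicator E \<xi>"
    proof (cases "\<xi> \<in> E")
      case True
      have "\<bar>?g \<nu> \<xi> - ?g \<nu>' \<xi>\<bar> \<le> \<delta>"
        by (rule down_closed_measure_diff[OF \<nu> \<nu>' \<delta>]) (use down[OF \<xi>] in auto)
      with True show ?thesis by simp
    next
      case False
      from triv[OF \<xi> this] have "(\<lambda>y. (y, \<xi>)) -` H = UNIV \<or> (\<lambda>y. (y, \<xi>)) -` H = {}" by auto
      then show ?thesis using False \<nu>.prob_space \<nu>'.prob_space by auto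
    qed
  qed (use s E in \<open>auto intro!: integrable_mult_right integrable_real_indicator simp: Q.emeasure_eq_measure\<close>)
  also have "\<dots> = \<delta> * measure Q E" using E by simp
  finally show ?thesis .
qed

section \<open>The recursion over one cycle\<close>

locale monotone_recursion =
  fixes S :: "'z measure" and f :: "real \<Rightarrow> 'z \<Rightarrow> real" and a b :: real and z0 :: 'z
  assumes ab: "a < b"
    and f_measurable: "(\<lambda>(x, z). f x z) \<in> restrict_space borel {a..b} \<Otimes>\<^sub>M S \<rightarrow>\<^sub>M restrict_space borel {a..b}"
    and f_mono: "\<And>z. z \<in> space S \<Longrightarrow> mono_on {a..b} (\<lambda>x. f x z)"
    and z0: "z0 \<in> space S"
begin

text \<open>The function \<open>f\<close> is controlled on \<open>{a..b}\<close> only.  Projecting initial values onto this interval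
  extends the flow monotonically and measurably to the whole line, so that it can act on arbitrary
  distributions on the real line.\<close>

definition clamp :: "real \<Rightarrow> real" where
  "clamp y = max a (min b y)"

definition flow :: "nat \<Rightarrow> real \<Rightarrow> 'z list \<Rightarrow> real" where
  "flow l y xs = iterate f l (clamp y) (nth_or z0 xs)"

text \<open>The random monotone map of the embedded chain: from the value at the start of a cycle to the
  value at its end.\<close>

definition cycle_map :: "real \<Rightarrow> 'z list \<Rightarrow> real" where
  "cycle_map y xs = flow (length xs) y xs"

lemma clamp_in: "clamp y \<in> {a..b}"
  using ab by (auto simp: clamp_def)

lemma clamp_id: "y \<in> {a..b} \<Longrightarrow> clamp y = y"
  by (auto simp: clamp_def)

lemma f_in: "x \<in> {a..b} \<Longrightarrow> z \<in> space S \<Longrightarrow> f x z \<in> {a..b}"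
  using measurable_space[OF f_measurable, of "(x, z)"] by (auto simp: space_pair_measure)

lemma iterate_in: "x \<in> {a..b} \<Longrightarrow> (\<And>i. i < l \<Longrightarrow> u i \<in> space S) \<Longrightarrow> iterate f l x u \<in> {a..b}"
  by (induction l) (auto simp del: atLeastAtMost_iff intro!: f_in)

lemma iterate_mono:
  assumes "x \<in> {a..b}" "y \<in> {a..b}" "x \<le> y" "\<And>i. i < l \<Longrightarrow> u i \<in> space S"
  shows "iterate f l x u \<le> iterate f l y u"
  using assms(4)
proof (induction l)
  case (Suc l)
  have "mono_on {a..b} (\<lambda>x. f x (u l))" using Suc.prems by (intro f_mono) auto
  moreover have "iterate f l x u \<in> {a..b}" "iterate f l y u \<in> {a..b}"
    using Suc.prems assms(1,2) by (auto simp del: atLeastAtMost_iff intro!: iterate_in)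
  moreover have "iterate f l x u \<le> iterate f l y u"
    using Suc.prems by (intro Suc.IH) auto
  ultimately show ?case by (auto dest: mono_onD simp del: atLeastAtMost_iff)
qed (use assms in simp)

lemma flow_in: "xs \<in> lists (space S) \<Longrightarrow> flow l y xs \<in> {a..b}"
  unfolding flow_def by (intro iterate_in clamp_in nth_or_in_space z0)

lemma flow_mono: "xs \<in> lists (space S) \<Longrightarrow> x \<le> y \<Longrightarrow> flow l x xs \<le> flow l y xs"
  unfolding flow_def by (intro iterate_mono clamp_in nth_or_in_space z0) (auto simp: clamp_def)

lemma cycle_map_in: "xs \<in> lists (space S) \<Longrightarrow> cycle_map y xs \<in> {a..b}"
  unfolding cycle_map_def by (rule flow_in)

lemma cycle_map_mono: "xs \<in> lists (space S) \<Longrightarrow> x \<le> y \<Longrightarrow> cycle_map x xs \<le> cycle_map y xs"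
  unfolding cycle_map_def by (rule flow_mono)

lemma measurable_flow [measurable]:
  "(\<lambda>p. flow l (fst p) (snd p)) \<in> borel \<Otimes>\<^sub>M cycle_space S \<rightarrow>\<^sub>M borel"
proof -
  let ?N = "borel \<Otimes>\<^sub>M cycle_space S"
  have "(\<lambda>p. flow l (fst p) (snd p)) \<in> ?N \<rightarrow>\<^sub>M restrict_space borel {a..b}"
  proof (induction l)
    case 0
    have "(\<lambda>p. clamp (fst p)) \<in> ?N \<rightarrow>\<^sub>M borel" unfolding clamp_def by measurable
    then show ?case using clamp_in by (auto simp: flow_def intro!: measurable_restrict_space2)
  next
    case (Suc l)
    have "(\<lambda>p. nth_or z0 (snd p) l) \<in> ?N \<rightarrow>\<^sub>M S"
      by (rule measurable_compose[OF measurable_snd measurable_nth_or[OF z0]])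
    from measurable_compose[OF measurable_Pair[OF Suc.IH this] f_measurable]
    show ?case by (simp add: flow_def)
  qed
  then show ?thesis by (simp add: measurable_restrict_space2_iff)
qed

lemma measurable_cycle_map [measurable]:
  "(\<lambda>p. cycle_map (fst p) (snd p)) \<in> borel \<Otimes>\<^sub>M cycle_space S \<rightarrow>\<^sub>M borel"
  unfolding cycle_map_def
  by (rule measurable_compose_countable[where f="\<lambda>l p. flow l (fst p) (snd p)"]) measurable

end

section \<open>Contraction of the embedded chain\<close>

text \<open>The embedded chain in isolation: \<open>Q\<close> is an arbitrary law of a cycle.\<close>

locale cycle_kernel = monotone_recursion S f a b z0 + Q: prob_space Q
  for S :: "'z measure" and f a b z0 and Q :: "'z list measure" +
  assumes sets_Q [measurable_cong]: "sets Q = sets (cycle_space S)"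
begin

lemma space_Q: "space Q = lists (space S)"
  using sets_eq_imp_space_eq[OF sets_Q] by simp

definition step :: "real measure \<Rightarrow> real measure" where
  "step \<nu> = distr (\<nu> \<Otimes>\<^sub>M Q) borel (\<lambda>p. cycle_map (fst p) (snd p))"

lemma measurable_cycle_map_pair:
  assumes "real_distribution \<nu>"
  shows "(\<lambda>p. cycle_map (fst p) (snd p)) \<in> \<nu> \<Otimes>\<^sub>M Q \<rightarrow>\<^sub>M borel"
proof -
  interpret real_distribution \<nu> by fact
  have [measurable_cong]: "sets \<nu> = sets borel" by simp
  show ?thesis by measurable
qed

lemma real_distribution_step:
  assumes "real_distribution \<nu>"
  shows "real_distribution (step \<nu>)"
proof -
  interpret \<nu>: real_distribution \<nu> by fact
  interpret pair_prob_space \<nu> Q ..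
  show ?thesis
    unfolding step_def using measurable_cycle_map_pair[OF assms] by (rule real_distribution_distr)
qed

lemma real_distribution_step_power:
  "real_distribution \<nu> \<Longrightarrow> real_distribution ((step ^^ n) \<nu>)"
  by (induction n) (auto intro: real_distribution_step)

lemma cdf_step:
  assumes "real_distribution \<nu>"
  shows "cdf (step \<nu>) r = measure (\<nu> \<Otimes>\<^sub>M Q) {p \<in> space (borel \<Otimes>\<^sub>M Q). cycle_map (fst p) (snd p) \<le> r}"
proof -
  interpret \<nu>: real_distribution \<nu> by fact
  have "space (\<nu> \<Otimes>\<^sub>M Q) = space (borel \<Otimes>\<^sub>M Q)"
    by (simp add: space_pair_measure)
  moreover have "(\<lambda>p. cycle_map (fst p) (snd p)) -` {..r} = {p. cycle_map (fst p) (snd p) \<le> r}"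
    by auto
  ultimately show ?thesis
    using measurable_cycle_map_pair[OF assms]
    by (simp add: cdf_def step_def measure_distr Collect_conj_eq Int_commute)
qed

lemma measure_step_interval:
  assumes "real_distribution \<nu>"
  shows "measure (step \<nu>) {a..b} = 1"
proof -
  interpret \<nu>: real_distribution \<nu> by fact
  interpret P: pair_prob_space \<nu> Q ..
  have "(\<lambda>p. cycle_map (fst p) (snd p)) -` {a..b} \<inter> space (\<nu> \<Otimes>\<^sub>M Q) = space (\<nu> \<Otimes>\<^sub>M Q)"
    using cycle_map_in by (force simp: space_pair_measure space_Q)
  then show ?thesis
    using measurable_cycle_map_pair[OF assms] P.prob_space by (simp add: step_def measure_distr)
qed

text \<open>The splitting argument.  The sections of \<open>{(y, \<xi>). cycle_map y \<xi> \<le> r}\<close> are down-closed, and on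
  an event of probability at least \<open>\<epsilon>\<close> they are trivial, because the image of the whole interval
  lies on one side of \<open>c\<close>.\<close>

lemma step_contraction:
  assumes \<nu>: "real_distribution \<nu>" and \<nu>': "real_distribution \<nu>'"
    and \<delta>: "\<And>r. \<bar>cdf \<nu> r - cdf \<nu>' r\<bar> \<le> \<delta>"
    and below: "\<epsilon> \<le> measure Q {\<xi> \<in> space Q. cycle_map b \<xi> \<le> c}"
    and above: "\<epsilon> \<le> measure Q {\<xi> \<in> space Q. c \<le> cycle_map a \<xi>}"
  shows "\<bar>cdf (step \<nu>) r - cdf (step \<nu>') r\<bar> \<le> (1 - \<epsilon>) * \<delta>"
proof -
  let ?H = "{p \<in> space (borel \<Otimes>\<^sub>M Q). cycle_map (fst p) (snd p) \<le> r}"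
  \<comment> \<open>Which of the two hypotheses trivialises the section depends on the position of \<open>r\<close>
    relative to \<open>c\<close>.\<close>
  define good where "good = (if c \<le> r then {\<xi> \<in> space Q. cycle_map b \<xi> \<le> c}
    else {\<xi> \<in> space Q. c \<le> cycle_map a \<xi>})"
  have H: "?H \<in> sets (borel \<Otimes>\<^sub>M Q)" by measurable
  have cm: "(\<lambda>\<xi>. cycle_map y \<xi>) \<in> Q \<rightarrow>\<^sub>M borel" for y
    using measurable_compose[OF measurable_Pair1'[of y borel Q], of "\<lambda>p. cycle_map (fst p) (snd p)" borel]
    by simp
  have good: "good \<in> sets Q" unfolding good_def using cm by (cases "c \<le> r") simp_all
  have clamps: "cycle_map a \<xi> \<le> cycle_map y \<xi>" "cycle_map y \<xi> \<le> cycle_map b \<xi>" if "\<xi> \<in> space Q" for y \<xi>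
  proof -
    have eq: "cycle_map y \<xi> = cycle_map (clamp y) \<xi>"
      using clamp_id[OF clamp_in, of y] by (simp add: cycle_map_def flow_def)
    show "cycle_map a \<xi> \<le> cycle_map y \<xi>" "cycle_map y \<xi> \<le> cycle_map b \<xi>"
      unfolding eq using that clamp_in[of y] by (auto simp: space_Q intro!: cycle_map_mono)
  qed
  have "\<bar>cdf (step \<nu>) r - cdf (step \<nu>') r\<bar> \<le> \<delta> * measure Q (space Q - good)"
    unfolding cdf_step[OF \<nu>] cdf_step[OF \<nu>']
  proof (rule product_down_closed_measure_diff[OF \<nu> \<nu>' Q.prob_space_axioms \<delta> H])
    show "space Q - good \<in> sets Q" using good by auto
  next
    fix \<xi> x y :: "_" assume "\<xi> \<in> space Q" "(y, \<xi>) \<in> ?H" "x \<le> y"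
    then show "(x, \<xi>) \<in> ?H"
      using cycle_map_mono[of \<xi> x y] by (auto simp: space_pair_measure space_Q)
  next
    fix \<xi> assume \<xi>: "\<xi> \<in> space Q" "\<xi> \<notin> space Q - good"
    then have "\<xi> \<in> good" by auto
    show "(\<forall>y. (y, \<xi>) \<in> ?H) \<or> (\<forall>y. (y, \<xi>) \<notin> ?H)"
    proof (cases "c \<le> r")
      case True
      then have "cycle_map y \<xi> \<le> r" for y
        using \<open>\<xi> \<in> good\<close> clamps(2)[OF \<xi>(1), of y] by (auto simp: good_def)
      then show ?thesis using \<xi> by (auto simp: space_pair_measure)
    next
      case False
      then have "\<not> cycle_map y \<xi> \<le> r" for y
        using \<open>\<xi> \<in> good\<close> clamps(1)[OF \<xi>(1), of y] by (auto simp: good_def)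
      then show ?thesis by auto
    qed
  qed
  also have "\<delta> * measure Q (space Q - good) = (1 - measure Q good) * \<delta>"
    using Q.prob_compl[OF good] by simp
  also have "\<dots> \<le> (1 - \<epsilon>) * \<delta>"
  proof (rule mult_right_mono)
    show "1 - measure Q good \<le> 1 - \<epsilon>" using below above by (simp add: good_def)
    show "0 \<le> \<delta>" using \<delta>[of 0] by linarith
  qed
  finally show ?thesis .
qed

definition kernel_power :: "nat \<Rightarrow> real \<Rightarrow> real measure" where
  "kernel_power n x = (step ^^ n) (return borel x)"

lemma real_distribution_kernel_power: "real_distribution (kernel_power n x)"
  unfolding kernel_power_def
  by (intro real_distribution_step_power real_distribution.intro prob_space_return)
     (auto simp: real_distribution_axioms_def)

end

locale splitting_kernel = cycle_kernel +
  fixes c \<epsilon> :: real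
  assumes \<epsilon>: "0 < \<epsilon>" "\<epsilon> < 1"
    and below: "\<epsilon> \<le> measure Q {\<xi> \<in> space Q. cycle_map b \<xi> \<le> c}"
    and above: "\<epsilon> \<le> measure Q {\<xi> \<in> space Q. c \<le> cycle_map a \<xi>}"
begin

lemma step_power_contraction:
  assumes \<nu>: "real_distribution \<nu>" and \<nu>': "real_distribution \<nu>'"
  shows "\<bar>cdf ((step ^^ n) \<nu>) r - cdf ((step ^^ n) \<nu>') r\<bar> \<le> (1 - \<epsilon>) ^ n"
proof (induction n arbitrary: r)
  case 0
  interpret \<nu>: real_distribution \<nu> by fact
  interpret \<nu>': real_distribution \<nu>' by fact
  have "\<bar>cdf \<nu> r - cdf \<nu>' r\<bar> \<le> 1"
    using \<nu>.cdf_nonneg[of r] \<nu>.cdf_bounded_prob[of r] \<nu>'.cdf_nonneg[of r] \<nu>'.cdf_bounded_prob[of r]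
    by linarith
  then show ?case by simp
next
  case (Suc n)
  then show ?case
    using step_contraction[OF _ _ Suc.IH below above] \<nu> \<nu>' by (simp add: real_distribution_step_power)
qed

text \<open>After \<open>n\<close> common steps the distance between any two initial laws, here a point mass and the law
  after \<open>k\<close> steps, has shrunk from at most \<open>1\<close> to at most \<open>(1 - \<epsilon>) ^ n\<close>.\<close>

lemma kernel_power_Cauchy:
  "\<bar>cdf (kernel_power n x) r - cdf (kernel_power (n + k) y) r\<bar> \<le> (1 - \<epsilon>) ^ n"
  using step_power_contraction[OF real_distribution_kernel_power[of 0 x]
      real_distribution_kernel_power[of k y], of n r]
  by (simp add: kernel_power_def funpow_add)

lemma cdf_kernel_power_outside:
  assumes "x \<in> {a..b}"
  shows "r < a \<Longrightarrow> cdf (kernel_power n x) r = 0" and "b \<le> r \<Longrightarrow> cdf (kernel_power n x) r = 1"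
proof -
  interpret real_distribution "kernel_power n x" by (rule real_distribution_kernel_power)
  have 1: "prob {a..b} = 1"
  proof (cases n)
    case 0
    then show ?thesis using assms by (simp add: kernel_power_def measure_return)
  next
    case (Suc m)
    then show ?thesis
      using measure_step_interval[OF real_distribution_kernel_power[of m x]]
      by (simp add: kernel_power_def)
  qed
  show "cdf (kernel_power n x) r = 0" if "r < a"
  proof -
    have "prob ({..r} \<union> {a..b}) = prob {..r} + prob {a..b}"
      using that by (intro finite_measure_Union) auto
    then show ?thesis using 1 prob_le_1[of "{..r} \<union> {a..b}"] measure_nonneg[of _ "{..r}"]
      by (simp add: cdf_def antisym)
  qed
  show "cdf (kernel_power n x) r = 1" if "b \<le> r"
  proof -
    have "prob {a..b} \<le> prob {..r}" using that by (intro finite_measure_mono) auto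
    then show ?thesis using 1 prob_le_1[of "{..r}"] by (simp add: cdf_def)
  qed
qed

text \<open>The Cauchy property gives a uniform limit of the distribution functions.  Monotonicity, right
  continuity and the values outside \<open>{a..b}\<close> pass to a uniform limit, which is therefore again a
  distribution function.\<close>

lemma ex_limit_distribution:
  "\<exists>\<pi>. distribution_on a b \<pi> \<and> (\<forall>n x r. \<bar>cdf (kernel_power n x) r - cdf \<pi> r\<bar> \<le> (1 - \<epsilon>) ^ n)"
proof -
  have \<rho>: "(\<lambda>n. (1 - \<epsilon>) ^ n) \<longlonglongrightarrow> 0" using \<epsilon> by (intro LIMSEQ_power_zero) auto
  have "Cauchy (\<lambda>n. cdf (kernel_power n a) r)" for r
  proof (rule metric_CauchyI)
    fix e :: real assume "0 < e"
    then obtain N where N: "(1 - \<epsilon>) ^ N < e / 2"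
      using order_tendstoD(2)[OF \<rho>, of "e / 2"] by (auto simp: eventually_sequentially)
    have "dist (cdf (kernel_power m a) r) (cdf (kernel_power n a) r) < e" if "m \<ge> N" "n \<ge> N" for m n
      using kernel_power_Cauchy[of N a r "m - N" a] kernel_power_Cauchy[of N a r "n - N" a] N that
      by (auto simp: dist_real_def abs_le_iff)
    then show "\<exists>M. \<forall>m\<ge>M. \<forall>n\<ge>M. dist (cdf (kernel_power m a) r) (cdf (kernel_power n a) r) < e"
      by blast
  qed
  then have "\<exists>l. (\<lambda>n. cdf (kernel_power n a) r) \<longlonglongrightarrow> l" for r
    by (simp add: Cauchy_convergent_iff convergent_def)
  then obtain F where F: "\<And>r. (\<lambda>n. cdf (kernel_power n a) r) \<longlonglongrightarrow> F r" by metis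
  have rate: "\<bar>cdf (kernel_power n x) r - F r\<bar> \<le> (1 - \<epsilon>) ^ n" for n x r
  proof (rule tendsto_upperbound)
    show "(\<lambda>k. \<bar>cdf (kernel_power n x) r - cdf (kernel_power (n + k) a) r\<bar>)
        \<longlonglongrightarrow> \<bar>cdf (kernel_power n x) r - F r\<bar>"
      using LIMSEQ_ignore_initial_segment[OF F[of r], of n]
      by (intro tendsto_intros) (simp add: add.commute)
  qed (use kernel_power_Cauchy in auto)
  have lim: "uniform_limit UNIV (\<lambda>n. cdf (kernel_power n a)) F sequentially"
  proof (rule uniform_limitI)
    fix e :: real assume "0 < e"
    from order_tendstoD(2)[OF \<rho> this]
    show "\<forall>\<^sub>F n in sequentially. \<forall>r\<in>UNIV. dist (cdf (kernel_power n a) r) (F r) < e"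
      by eventually_elim (use rate[of _ a] in \<open>auto simp: dist_real_def intro: le_less_trans\<close>)
  qed
  have mono: "F r \<le> F s" if "r \<le> s" for r s
    by (rule LIMSEQ_le[OF F F])
      (use that finite_borel_measure.cdf_nondecreasing
        [OF real_distribution.finite_borel_measure_M[OF real_distribution_kernel_power]] in blast)
  have cont: "continuous (at_right r) F" for r
    unfolding continuous_within
  proof (rule swap_uniform_limit[where F=sequentially and S="{r<..}" and g="\<lambda>n. cdf (kernel_power n a) r"])
    show "\<forall>\<^sub>F n in sequentially. (cdf (kernel_power n a) \<longlongrightarrow> cdf (kernel_power n a) r) (at_right r)"
      using finite_borel_measure.cdf_is_right_cont
        [OF real_distribution.finite_borel_measure_M[OF real_distribution_kernel_power]]
      by (auto simp: continuous_within)
    show "uniform_limit {r<..} (\<lambda>n. cdf (kernel_power n a)) F sequentially"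
      using lim by (rule uniform_limit_on_subset) auto
  qed (use F in auto)
  have below_a: "F r = 0" if "r < a" for r
    using F[of r] cdf_kernel_power_outside(1)[of a r] that ab by (simp add: LIMSEQ_const_iff)
  have above_b: "F r = 1" if "b \<le> r" for r
    using F[of r] cdf_kernel_power_outside(2)[of a r] that ab by (simp add: LIMSEQ_const_iff)
  have bot: "(F \<longlongrightarrow> 0) at_bot"
    by (rule tendsto_eventually) (use below_a in \<open>auto simp: eventually_at_bot_dense\<close>)
  have top: "(F \<longlongrightarrow> 1) at_top"
    by (rule tendsto_eventually) (use above_b in \<open>auto simp: eventually_at_top_linorder\<close>)
  let ?\<pi> = "interval_measure F"
  interpret \<pi>: real_distribution ?\<pi>
    by (rule real_distribution_interval_measure[OF mono cont bot top])
  have cdf: "cdf ?\<pi> = F" by (rule cdf_interval_measure[OF mono cont bot])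
  have "(F \<longlongrightarrow> \<pi>.prob {..<a}) (at_left a)" using \<pi>.cdf_at_left[of a] cdf by simp
  moreover have "(F \<longlongrightarrow> 0) (at_left a)"
    by (rule tendsto_eventually) (use below_a in \<open>auto simp: eventually_at_left_field intro: exI[of _ "a - 1"]\<close>)
  ultimately have "\<pi>.prob {..<a} = 0" by (rule tendsto_unique[rotated]) simp
  moreover have "\<pi>.prob {..b} = 1" using above_b[of b] fun_cong[OF cdf, of b] by (simp add: cdf_def)
  moreover have "{..b} = {..<a} \<union> {a..b}" using ab by auto
  moreover have "\<pi>.prob ({..<a} \<union> {a..b}) = \<pi>.prob {..<a} + \<pi>.prob {a..b}"
    by (rule \<pi>.finite_measure_Union) auto
  ultimately have "distribution_on a b ?\<pi>"
    by (simp add: distribution_on_def \<pi>.real_distribution_axioms)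
  then show ?thesis using rate cdf by auto
qed

end

section \<open>The recursion along successive cycles\<close>

lemma iterate_add:
  "iterate f (m + n) x u = iterate f n (iterate f m x u) (\<lambda>i. u (m + i))"
  by (induction n) simp_all

lemma iterate_cong:
  "(\<And>i. i < l \<Longrightarrow> u i = v i) \<Longrightarrow> iterate f l x u = iterate f l x v"
  by (induction l) simp_all

lemma recursion_eq_iterate: "recursion f Z x t \<omega> = iterate f t x (\<lambda>i. Z i \<omega>)"
  by (induction t) simp_all

lemma aux_process_eq_iterate:
  "aux_process f Z T x t \<omega> = iterate f t x (\<lambda>i. Z (T 0 \<omega> + i) \<omega>)"
  by (simp add: aux_process_def recursion_eq_iterate)

definition cycles_time :: "nat \<Rightarrow> (nat \<Rightarrow> 'z list) \<Rightarrow> nat" where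
  "cycles_time m s = (\<Sum>j<m. length (s j))"

primrec (in monotone_recursion) cycles_value :: "nat \<Rightarrow> real \<Rightarrow> (nat \<Rightarrow> 'z list) \<Rightarrow> real" where
  "cycles_value 0 y s = y"
| "cycles_value (Suc m) y s = cycle_map (cycles_value m y s) (s m)"

lemma (in monotone_recursion) cycles_value_cong:
  "(\<And>j. j < m \<Longrightarrow> s j = s' j) \<Longrightarrow> cycles_value m y s = cycles_value m y s'"
  by (induction m) simp_all

lemma (in monotone_recursion) cycles_value_in:
  "y \<in> {a..b} \<Longrightarrow> (\<And>j. j < m \<Longrightarrow> s j \<in> lists (space S)) \<Longrightarrow> cycles_value m y s \<in> {a..b}"
  by (cases m) (auto simp del: atLeastAtMost_iff in_lists_conv_set intro!: cycle_map_in)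

lemma (in monotone_recursion) cycles_value_mono:
  "x \<le> y \<Longrightarrow> (\<And>j. j < m \<Longrightarrow> s j \<in> lists (space S)) \<Longrightarrow> cycles_value m x s \<le> cycles_value m y s"
  by (induction m) (auto simp del: in_lists_conv_set intro!: cycle_map_mono)

lemma (in monotone_recursion) measurable_cycles_value:
  assumes "\<And>j. j < m \<Longrightarrow> (\<lambda>x. s x j) \<in> N \<rightarrow>\<^sub>M cycle_space S"
  shows "(\<lambda>x. cycles_value m y (s x)) \<in> N \<rightarrow>\<^sub>M borel"
  using assms
proof (induction m)
  case (Suc m)
  have "(\<lambda>x. cycles_value m y (s x)) \<in> N \<rightarrow>\<^sub>M borel" "(\<lambda>x. s x m) \<in> N \<rightarrow>\<^sub>M cycle_space S"
    using Suc by auto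
  from measurable_compose[OF measurable_Pair[OF this] measurable_cycle_map]
  show ?case by simp
qed simp

lemma measurable_cycles_time:
  assumes "\<And>j. j < m \<Longrightarrow> (\<lambda>x. s x j) \<in> N \<rightarrow>\<^sub>M cycle_space S"
  shows "(\<lambda>x. cycles_time m (s x)) \<in> N \<rightarrow>\<^sub>M count_space UNIV"
  using assms
proof (induction m)
  case (Suc m)
  have "(\<lambda>x. cycles_time m (s x)) \<in> N \<rightarrow>\<^sub>M count_space UNIV"
    "(\<lambda>x. length (s x m)) \<in> N \<rightarrow>\<^sub>M count_space UNIV"
    using Suc measurable_compose[OF Suc.prems measurable_length_cycle] by auto
  then have "(\<lambda>x. cycles_time m (s x) + length (s x m)) \<in> N \<rightarrow>\<^sub>M count_space UNIV"
    by measurable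
  then show ?case by (simp add: cycles_time_def)
qed (simp add: cycles_time_def)

locale regenerative_recursion = M: prob_space M + monotone_recursion S f a b z0
  for M :: "'w measure" and S :: "'z measure" and f a b z0 +
  fixes Z :: "nat \<Rightarrow> 'w \<Rightarrow> 'z" and T :: "nat \<Rightarrow> 'w \<Rightarrow> nat"
  assumes reg: "regenerative M S Z T"
begin

abbreviation "C \<equiv> cycle Z T"

abbreviation "cycle_sequences \<equiv> PiM (UNIV :: nat set) (\<lambda>_. cycle_space S)"

definition Q :: "'z list measure" where
  "Q = distr M (cycle_space S) (C 1)"

definition future :: "nat \<Rightarrow> 'w \<Rightarrow> nat \<Rightarrow> 'z list" where
  "future k \<omega> j = C (Suc k + j) \<omega>"

lemma Z_measurable: "Z t \<in> M \<rightarrow>\<^sub>M S"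
  and T_measurable [measurable]: "T n \<in> M \<rightarrow>\<^sub>M count_space UNIV"
  and T_less_Suc: "\<omega> \<in> space M \<Longrightarrow> T n \<omega> < T (Suc n) \<omega>"
  and indep_cycles: "M.indep_vars (\<lambda>_. cycle_space S) C UNIV"
  and distr_cycle: "1 \<le> n \<Longrightarrow> distr M (cycle_space S) (C n) = Q"
  using reg unfolding regenerative_def Q_def by blast+

lemma Z_in: "\<omega> \<in> space M \<Longrightarrow> Z t \<omega> \<in> space S"
  using Z_measurable by (rule measurable_space)

lemma C_measurable [measurable]: "C n \<in> M \<rightarrow>\<^sub>M cycle_space S"
  using indep_cycles unfolding M.indep_vars_def by auto

lemma C_in: "\<omega> \<in> space M \<Longrightarrow> C n \<omega> \<in> lists (space S)"
  using measurable_space[OF C_measurable] by simp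

lemma future_in: "\<omega> \<in> space M \<Longrightarrow> future k \<omega> j \<in> lists (space S)"
  unfolding future_def by (rule C_in)

lemma future_measurable [measurable]: "future k \<in> M \<rightarrow>\<^sub>M cycle_sequences"
proof -
  have "(\<lambda>\<omega> j. C (Suc k + j) \<omega>) \<in> M \<rightarrow>\<^sub>M cycle_sequences"
    by (rule measurable_abs_UNIV) measurable
  then show ?thesis by (simp add: future_def[abs_def])
qed

lemma length_C: "length (C n \<omega>) = cycle_length T n \<omega>"
  by (simp add: cycle_def cycle_length_def)

lemma T_Suc: "\<omega> \<in> space M \<Longrightarrow> T (Suc k) \<omega> = T k \<omega> + length (C (Suc k) \<omega>)"
  using T_less_Suc[of \<omega> k] by (simp add: cycle_def prev_time_def)

lemma length_C_pos: "\<omega> \<in> space M \<Longrightarrow> 0 < length (C (Suc k) \<omega>)"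
  using T_less_Suc[of \<omega> k] by (simp add: cycle_def prev_time_def)

lemma T_eq_sum: "\<omega> \<in> space M \<Longrightarrow> T k \<omega> = (\<Sum>i\<le>k. length (C i \<omega>))"
  by (induction k) (auto simp: T_Suc, simp add: cycle_def prev_time_def)

lemma T_add: "\<omega> \<in> space M \<Longrightarrow> T (k + m) \<omega> = T k \<omega> + cycles_time m (future k \<omega>)"
  by (induction m) (simp_all add: cycles_time_def future_def T_Suc)

lemma T_mono: "\<omega> \<in> space M \<Longrightarrow> i \<le> j \<Longrightarrow> T i \<omega> \<le> T j \<omega>"
  using T_add[of \<omega> i "j - i"] by simp

lemma le_T: "\<omega> \<in> space M \<Longrightarrow> k \<le> T k \<omega>"
  by (induction k) (use T_less_Suc le_less_trans Suc_leI in blast)+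

lemma nth_C: "i < length (C (Suc k) \<omega>) \<Longrightarrow> nth_or z0 (C (Suc k) \<omega>) i = Z (T k \<omega> + i) \<omega>"
  by (simp add: nth_or_def cycle_def prev_time_def)

lemma iterate_within_cycle:
  assumes "l \<le> length (C (Suc k) \<omega>)" "y \<in> {a..b}"
  shows "iterate f l y (\<lambda>i. Z (T k \<omega> + i) \<omega>) = flow l y (C (Suc k) \<omega>)"
  unfolding flow_def clamp_id[OF assms(2)]
  by (rule iterate_cong) (use assms(1) in \<open>auto simp: nth_C\<close>)

text \<open>Up to a regeneration time the recursion is a function of complete cycles; this passes from the
  driving sequence, indexed by time, to the independent cycles.\<close>

lemma iterate_cycles:
  assumes "\<omega> \<in> space M" "y \<in> {a..b}"
  shows "iterate f (cycles_time m (future k \<omega>)) y (\<lambda>i. Z (T k \<omega> + i) \<omega>) = cycles_value m y (future k \<omega>)"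
proof (induction m)
  case (Suc m)
  let ?s = "future k \<omega>"
  have "cycles_value m y ?s \<in> {a..b}"
    using assms future_in by (intro cycles_value_in)
  moreover have "(\<lambda>i. Z (T k \<omega> + (cycles_time m ?s + i)) \<omega>) = (\<lambda>i. Z (T (k + m) \<omega> + i) \<omega>)"
    using T_add[OF assms(1)] by (simp add: add.assoc)
  moreover have "cycles_time (Suc m) ?s = cycles_time m ?s + length (C (Suc (k + m)) \<omega>)"
    by (simp add: cycles_time_def future_def)
  ultimately show ?case
    using Suc.IH by (simp add: iterate_add iterate_within_cycle cycle_map_def)
      (simp add: future_def)
qed (simp add: cycles_time_def)

lemma recursion_in: "\<omega> \<in> space M \<Longrightarrow> x \<in> {a..b} \<Longrightarrow> recursion f Z x t \<omega> \<in> {a..b}"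
  unfolding recursion_eq_iterate using Z_in by (intro iterate_in)

lemma recursion_at_regeneration:
  assumes "\<omega> \<in> space M" "x \<in> {a..b}"
  shows "recursion f Z x (T (k + m) \<omega>) \<omega> = cycles_value m (recursion f Z x (T k \<omega>) \<omega>) (future k \<omega>)"
proof -
  have "recursion f Z x (T k \<omega>) \<omega> \<in> {a..b}"
    using assms by (intro recursion_in)
  then show ?thesis
    using iterate_cycles[OF assms(1)]
    by (simp add: recursion_eq_iterate T_add[OF assms(1), of k m] iterate_add)
qed

lemma recursion_after_regeneration:
  assumes "\<omega> \<in> space M" "x \<in> {a..b}" "l \<le> length (C (Suc k) \<omega>)"
  shows "recursion f Z x (T k \<omega> + l) \<omega> = flow l (recursion f Z x (T k \<omega>) \<omega>) (C (Suc k) \<omega>)"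
proof -
  have "recursion f Z x (T k \<omega>) \<omega> \<in> {a..b}"
    using assms by (intro recursion_in)
  then show ?thesis
    using iterate_within_cycle[OF assms(3)] by (simp add: recursion_eq_iterate iterate_add)
qed

subsection \<open>Independence of the past and the future cycles\<close>

lemma indep_past_future:
  "M.indep_var (PiM {..k} (\<lambda>_. cycle_space S)) (\<lambda>\<omega>. restrict (\<lambda>i. C i \<omega>) {..k}) cycle_sequences (future k)"
proof -
  let ?g = "\<lambda>s j. s (Suc k + j) :: 'z list"
  have "(\<lambda>s. s (Suc k + j)) \<in> PiM {Suc k..} (\<lambda>_. cycle_space S) \<rightarrow>\<^sub>M cycle_space S" for j
    by (rule measurable_component_singleton) simp
  then have g: "?g \<in> PiM {Suc k..} (\<lambda>_. cycle_space S) \<rightarrow>\<^sub>M cycle_sequences"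
    by (rule measurable_abs_UNIV)
  have "M.indep_var (PiM {..k} (\<lambda>_. cycle_space S)) (\<lambda>\<omega>. restrict (\<lambda>i. C i \<omega>) {..k})
      (PiM {Suc k..} (\<lambda>_. cycle_space S)) (\<lambda>\<omega>. restrict (\<lambda>i. C i \<omega>) {Suc k..})"
    by (rule M.indep_var_restrict[OF indep_cycles]) auto
  from M.indep_var_compose[OF this measurable_ident_sets[OF refl] g]
  have "M.indep_var (PiM {..k} (\<lambda>_. cycle_space S)) (\<lambda>\<omega>. restrict (\<lambda>i. C i \<omega>) {..k})
      cycle_sequences (?g \<circ> (\<lambda>\<omega>. restrict (\<lambda>i. C i \<omega>) {Suc k..}))"
    by (simp add: comp_def)
  also have "?g \<circ> (\<lambda>\<omega>. restrict (\<lambda>i. C i \<omega>) {Suc k..}) = future k"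
    by (simp add: fun_eq_iff future_def)
  finally show ?thesis .
qed

lemma distr_future: "distr M cycle_sequences (future k) = PiM UNIV (\<lambda>_. Q)"
proof -
  have "M.indep_vars (\<lambda>j. PiM {Suc k + j} (\<lambda>_. cycle_space S))
      (\<lambda>j \<omega>. restrict (\<lambda>i. C i \<omega>) {Suc k + j}) UNIV"
    by (rule M.indep_vars_restrict[OF indep_cycles]) (auto simp: disjoint_family_on_def)
  then have "M.indep_vars (\<lambda>_. cycle_space S)
      (\<lambda>j \<omega>. (\<lambda>s. s (Suc k + j)) (restrict (\<lambda>i. C i \<omega>) {Suc k + j})) UNIV"
    by (rule M.indep_vars_compose2) (auto intro: measurable_component_singleton)
  then have "M.indep_vars (\<lambda>_. cycle_space S) (\<lambda>j. C (Suc k + j)) UNIV"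
    by simp
  then have "distr M cycle_sequences (\<lambda>\<omega>. \<lambda>j\<in>UNIV. C (Suc k + j) \<omega>)
      = PiM UNIV (\<lambda>j. distr M (cycle_space S) (C (Suc k + j)))"
    by (subst (asm) M.indep_vars_iff_distr_eq_PiM) auto
  then show ?thesis
    by (simp add: distr_cycle future_def[abs_def] restrict_UNIV)
qed

lemma prob_future:
  assumes "B \<in> sets cycle_sequences"
  shows "M.prob {\<omega> \<in> space M. future k \<omega> \<in> B} = M.prob {\<omega> \<in> space M. future 0 \<omega> \<in> B}"
proof -
  have "M.prob {\<omega> \<in> space M. future k \<omega> \<in> B} = measure (distr M cycle_sequences (future k)) B" for k
    using assms by (subst measure_distr) (auto intro!: arg_cong[where f=M.prob])
  then show ?thesis by (simp add: distr_future)
qed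

text \<open>The strong Markov property at the regeneration times: \<open>T k\<close> is determined by the cycles up to
  \<open>k\<close>, and the cycles after \<open>T k\<close> are independent of these and distributed as those after \<open>T 0\<close>.\<close>

lemma prob_regeneration_future:
  assumes B: "B \<in> sets cycle_sequences"
  shows "M.prob {\<omega> \<in> space M. T k \<omega> = v \<and> future k \<omega> \<in> B}
    = M.prob {\<omega> \<in> space M. T k \<omega> = v} * M.prob {\<omega> \<in> space M. future 0 \<omega> \<in> B}"
proof -
  let ?past = "\<lambda>\<omega>. restrict (\<lambda>i. C i \<omega>) {..k}"
  let ?P = "PiM {..k} (\<lambda>_. cycle_space S)"
  let ?A = "{s \<in> space ?P. cycles_time (Suc k) s = v}"
  have "(\<lambda>s. cycles_time (Suc k) s) \<in> ?P \<rightarrow>\<^sub>M count_space UNIV"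
    by (rule measurable_cycles_time[where S=S]) (auto intro: measurable_component_singleton)
  then have A: "?A \<in> sets ?P" by measurable
  have past: "?past \<in> M \<rightarrow>\<^sub>M ?P" by (rule measurable_restrict) measurable
  have iff: "?past \<omega> \<in> ?A \<longleftrightarrow> T k \<omega> = v" if "\<omega> \<in> space M" for \<omega>
    using measurable_space[OF past that] T_eq_sum[OF that, of k]
    by (simp add: cycles_time_def lessThan_Suc_atMost)
  have "(\<lambda>\<omega>. (?past \<omega>, future k \<omega>)) -` (?A \<times> B) \<inter> space M
      = {\<omega> \<in> space M. T k \<omega> = v \<and> future k \<omega> \<in> B}"
    using iff by blast
  moreover have "?past -` ?A \<inter> space M = {\<omega> \<in> space M. T k \<omega> = v}"
    using iff by blast
  moreover have "future k -` B \<inter> space M = {\<omega> \<in> space M. future k \<omega> \<in> B}"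
    by blast
  ultimately show ?thesis
    using M.indep_varD[OF indep_past_future A B] prob_future[OF B, of k] by simp
qed

lemma measure_Q_eq:
  assumes "{\<xi> \<in> space (cycle_space S). P \<xi>} \<in> sets (cycle_space S)"
  shows "measure Q {\<xi> \<in> space Q. P \<xi>} = M.prob {\<omega> \<in> space M. P (C 1 \<omega>)}"
proof -
  have "measure Q {\<xi> \<in> space Q. P \<xi>} = M.prob (C 1 -` {\<xi> \<in> space (cycle_space S). P \<xi>} \<inter> space M)"
    unfolding Q_def space_distr by (rule measure_distr[OF C_measurable assms])
  also have "C 1 -` {\<xi> \<in> space (cycle_space S). P \<xi>} \<inter> space M = {\<omega> \<in> space M. P (C 1 \<omega>)}"
    using measurable_space[OF C_measurable] by blast
  finally show ?thesis .
qed

lemma prob_space_Q: "prob_space Q"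
  unfolding Q_def by (rule M.prob_space_distr) measurable

sublocale cycle_kernel S f a b z0 Q
proof (intro cycle_kernel.intro cycle_kernel_axioms.intro)
  show "monotone_recursion S f a b z0" by (rule monotone_recursion_axioms)
  show "prob_space Q" by (rule prob_space_Q)
  show "sets Q = sets (cycle_space S)" by (simp add: Q_def)
qed

lemma cycles_value_future_measurable [measurable]:
  "(\<lambda>\<omega>. cycles_value m y (future k \<omega>)) \<in> M \<rightarrow>\<^sub>M borel"
  by (rule measurable_cycles_value) (simp add: future_def)

text \<open>The value after \<open>m\<close> cycles depends on these cycles only, so it is independent of the next one;
  hence each further cycle acts on its law as one step of the kernel.\<close>

lemma distr_value_cycle:
  "distr M borel (\<lambda>\<omega>. cycles_value m y (future 0 \<omega>)) = kernel_power m y"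
  "distr M (borel \<Otimes>\<^sub>M cycle_space S) (\<lambda>\<omega>. (cycles_value m y (future 0 \<omega>), C (Suc m) \<omega>))
    = kernel_power m y \<Otimes>\<^sub>M Q"
proof -
  let ?V = "\<lambda>m \<omega>. cycles_value m y (future 0 \<omega>)"
  have pair: "distr M (borel \<Otimes>\<^sub>M cycle_space S) (\<lambda>\<omega>. (?V m \<omega>, C (Suc m) \<omega>))
      = distr M borel (?V m) \<Otimes>\<^sub>M Q" for m
  proof -
    let ?past = "\<lambda>\<omega>. restrict (\<lambda>i. C i \<omega>) {..m}"
    have 1: "(\<lambda>s. cycles_value m y (\<lambda>j. s (Suc j))) \<in> PiM {..m} (\<lambda>_. cycle_space S) \<rightarrow>\<^sub>M borel"
      by (intro measurable_cycles_value measurable_component_singleton) auto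
    have 2: "(\<lambda>s. s 0) \<in> cycle_sequences \<rightarrow>\<^sub>M cycle_space S"
      by (rule measurable_component_singleton) simp
    have "cycles_value m y (\<lambda>j. ?past \<omega> (Suc j)) = ?V m \<omega>" for \<omega>
      by (rule cycles_value_cong) (simp add: future_def)
    moreover have "future m \<omega> 0 = C (Suc m) \<omega>" for \<omega> by (simp add: future_def)
    moreover have past: "?past \<in> M \<rightarrow>\<^sub>M PiM {..m} (\<lambda>_. cycle_space S)"
      by (rule measurable_restrict) measurable
    ultimately have V: "distr (distr M (PiM {..m} (\<lambda>_. cycle_space S)) ?past) borel
          (\<lambda>s. cycles_value m y (\<lambda>j. s (Suc j))) = distr M borel (?V m)"
      and C: "distr (distr M cycle_sequences (future m)) (cycle_space S) (\<lambda>s. s 0) = Q"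
      using 1 2 by (simp_all add: distr_distr comp_def distr_cycle)
    have "distr M borel (?V m) \<Otimes>\<^sub>M Q
        = distr (distr M (PiM {..m} (\<lambda>_. cycle_space S)) ?past \<Otimes>\<^sub>M distr M cycle_sequences (future m))
            (borel \<Otimes>\<^sub>M cycle_space S) (\<lambda>(s, s'). (cycles_value m y (\<lambda>j. s (Suc j)), s' 0))"
      unfolding V[symmetric] C[symmetric]
      by (rule pair_measure_distr)
        (use 1 2 prob_space_Q in \<open>simp_all add: C prob_space_imp_sigma_finite\<close>)
    also have "\<dots> = distr M (borel \<Otimes>\<^sub>M cycle_space S) (\<lambda>\<omega>. (?V m \<omega>, C (Suc m) \<omega>))"
      using indep_past_future[of m] 1 2 past \<open>\<And>\<omega>. cycles_value m y (\<lambda>j. ?past \<omega> (Suc j)) = ?V m \<omega>\<close>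
        \<open>\<And>\<omega>. future m \<omega> 0 = C (Suc m) \<omega>\<close>
      by (simp add: M.indep_var_distribution_eq distr_distr comp_def)
    finally show ?thesis ..
  qed
  have "distr M borel (?V m) = kernel_power m y" for m
  proof (induction m)
    case 0
    then show ?case by (simp add: kernel_power_def M.distr_const)
  next
    case (Suc m)
    have "distr M borel (?V (Suc m))
        = distr (distr M (borel \<Otimes>\<^sub>M cycle_space S) (\<lambda>\<omega>. (?V m \<omega>, C (Suc m) \<omega>))) borel
            (\<lambda>p. cycle_map (fst p) (snd p))"
      by (subst distr_distr) (simp_all add: comp_def future_def[of 0])
    also have "\<dots> = step (kernel_power m y)"
      by (simp add: pair Suc.IH step_def)
    finally show ?case by (simp add: kernel_power_def)
  qed
  then show "distr M borel (?V m) = kernel_power m y"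
    "distr M (borel \<Otimes>\<^sub>M cycle_space S) (\<lambda>\<omega>. (?V m \<omega>, C (Suc m) \<omega>)) = kernel_power m y \<Otimes>\<^sub>M Q"
    using pair[of m] by simp_all
qed

lemma prob_value_cycle:
  assumes "H \<in> sets (borel \<Otimes>\<^sub>M cycle_space S)"
  shows "M.prob {\<omega> \<in> space M. (cycles_value m y (future 0 \<omega>), future 0 \<omega> m) \<in> H}
    = measure (kernel_power m y \<Otimes>\<^sub>M Q) H"
  unfolding distr_value_cycle(2)[symmetric]
  using assms by (subst measure_distr) (auto simp: future_def[of 0] intro!: arg_cong[where f=M.prob])

lemma aux_process_at_regeneration:
  assumes "\<omega> \<in> space M" "x \<in> {a..b}"
  shows "aux_process f Z T x (T n \<omega> - T 0 \<omega>) \<omega> = cycles_value n x (future 0 \<omega>)"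
  using iterate_cycles[OF assms, of n 0] T_add[OF assms(1), of 0 n]
  by (simp add: aux_process_eq_iterate)

lemma regen_distr_eq_kernel_power:
  assumes "x \<in> {a..b}"
  shows "regen_distr M f Z T n x = kernel_power n x"
proof -
  have "regen_distr M f Z T n x = distr M borel (\<lambda>\<omega>. cycles_value n x (future 0 \<omega>))"
    unfolding regen_distr_def using assms by (intro distr_cong aux_process_at_regeneration) auto
  then show ?thesis by (simp add: distr_value_cycle)
qed

end

section \<open>Renewal probabilities of the regeneration times\<close>

text \<open>Dominated convergence with an error \<open>\<kappa>\<close> that depends on the dominating sequence \<open>g\<close> alone; this
  is where the uniformity over all events \<open>{..r} \<times> A\<close> in the limit theorem comes from.\<close>

lemma convolution_uniform_tendsto:
  fixes u g :: "nat \<Rightarrow> real"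
  assumes u: "u \<longlonglongrightarrow> l" "\<And>n. 0 \<le> u n" "\<And>n. u n \<le> 1"
    and g: "summable g" "\<And>w. 0 \<le> g w"
  obtains \<kappa> where "\<kappa> \<longlonglongrightarrow> 0"
    "\<And>q t. (\<And>w. 0 \<le> q w) \<Longrightarrow> (\<And>w. q w \<le> g w) \<Longrightarrow>
       \<bar>(\<Sum>w\<le>t. q w * u (t - w)) - (\<Sum>w. q w) * l\<bar> \<le> \<kappa> t"
proof
  let ?\<kappa> = "\<lambda>t. (\<Sum>w\<le>t. g w * \<bar>u (t - w) - l\<bar>) + ((\<Sum>w. g w) - (\<Sum>w\<le>t. g w)) * l"
  have l: "0 \<le> l" using u by (intro LIMSEQ_le_const[OF u(1)]) auto
  have "(\<lambda>t. \<Sum>w\<le>t. g w * \<bar>u (t - w) - l\<bar>) \<longlonglongrightarrow> (\<Sum>w. g w) * 0"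
  proof (rule convolution_tendsto[OF g, where B="1 + l" and \<sigma>="\<lambda>t. t"])
    show "\<bar>\<bar>u n - l\<bar>\<bar> \<le> 1 + l" for n using u(2,3)[of n] l by auto
    have "(\<lambda>j. \<bar>u j - l\<bar>) \<longlonglongrightarrow> \<bar>l - l\<bar>" by (intro tendsto_intros u)
    then show "(\<lambda>j. \<bar>u (j - k) - l\<bar>) \<longlonglongrightarrow> 0" for k
      by (intro filterlim_compose[OF _ filterlim_minus_const_nat_at_top]) simp
  qed (simp add: filterlim_ident)
  moreover have "(\<lambda>t. ((\<Sum>w. g w) - (\<Sum>w\<le>t. g w)) * l) \<longlonglongrightarrow> ((\<Sum>w. g w) - (\<Sum>w. g w)) * l"
    by (intro tendsto_intros) (use summable_LIMSEQ'[OF g(1)] in simp)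
  ultimately show "?\<kappa> \<longlonglongrightarrow> 0" by (auto intro: tendsto_eq_intros)
  fix q :: "nat \<Rightarrow> real" and t
  assume q: "\<And>w. 0 \<le> q w" "\<And>w. q w \<le> g w"
  have sq: "summable q" by (rule summable_comparison_test[OF _ g(1)]) (use q in auto)
  have "(\<Sum>w\<le>t. g w - q w) \<le> (\<Sum>w. g w - q w)"
    by (rule sum_le_suminf) (use q in \<open>auto intro: summable_diff g sq\<close>)
  then have "(\<Sum>w. q w) - (\<Sum>w\<le>t. q w) \<le> (\<Sum>w. g w) - (\<Sum>w\<le>t. g w)"
    by (simp add: sum_subtractf suminf_diff[OF g(1) sq, symmetric])
  moreover have "(\<Sum>w\<le>t. q w) \<le> (\<Sum>w. q w)"
    by (rule sum_le_suminf[OF sq]) (use q in auto)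
  ultimately have tail: "\<bar>((\<Sum>w. q w) - (\<Sum>w\<le>t. q w)) * l\<bar> \<le> ((\<Sum>w. g w) - (\<Sum>w\<le>t. g w)) * l"
    using l by (simp add: abs_mult mult_right_mono)
  have "\<bar>\<Sum>w\<le>t. q w * (u (t - w) - l)\<bar> \<le> (\<Sum>w\<le>t. g w * \<bar>u (t - w) - l\<bar>)"
    by (rule order_trans[OF sum_abs]) (auto simp: abs_mult q intro!: sum_mono mult_right_mono)
  moreover have "(\<Sum>w\<le>t. q w * u (t - w)) - (\<Sum>w. q w) * l
      = (\<Sum>w\<le>t. q w * (u (t - w) - l)) - ((\<Sum>w. q w) - (\<Sum>w\<le>t. q w)) * l"
    by (simp add: algebra_simps sum_subtractf sum_distrib_left)
  ultimately show "\<bar>(\<Sum>w\<le>t. q w * u (t - w)) - (\<Sum>w. q w) * l\<bar> \<le> ?\<kappa> t"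
    using tail by linarith
qed

lemma suminf_delay_ennreal:
  fixes h :: "nat \<Rightarrow> ennreal"
  shows "(\<Sum>w. if j \<le> w then h (w - j) else 0) = (\<Sum>l. h l)"
proof (rule sums_unique[symmetric])
  have "(\<Sum>w<n + j. if j \<le> w then h (w - j) else 0) = (\<Sum>l<n. h l)" for n
    by (induction n) auto
  moreover have "(\<lambda>n. \<Sum>l<n. h l) \<longlonglongrightarrow> (\<Sum>l. h l)"
    using summable_LIMSEQ[OF summableI] .
  ultimately show "(\<lambda>w. if j \<le> w then h (w - j) else 0) sums (\<Sum>l. h l)"
    unfolding sums_def by (subst LIMSEQ_offset[where k=j]) simp_all
qed

context regenerative_recursion
begin

abbreviation regeneration_prob :: "nat \<Rightarrow> nat \<Rightarrow> real" where
  "regeneration_prob k v \<equiv> M.prob {\<omega> \<in> space M. T k \<omega> = v}"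

definition renewal_prob :: "nat \<Rightarrow> real" where
  "renewal_prob v = (\<Sum>k\<le>v. regeneration_prob k v)"

definition length_prob :: "nat \<Rightarrow> real" where
  "length_prob n = M.prob {\<omega> \<in> space M. cycle_length T 1 \<omega> = n}"

lemma cycle_length_measurable [measurable]: "cycle_length T 1 \<in> M \<rightarrow>\<^sub>M count_space UNIV"
  using measurable_compose[OF C_measurable measurable_length_cycle, of 1] by (simp add: length_C)

lemma regeneration_prob_eq_0: "v < k \<Longrightarrow> regeneration_prob k v = 0"
proof -
  assume "v < k"
  then have "{\<omega> \<in> space M. T k \<omega> = v} = {}" using le_T[of _ k] by (auto simp: not_less[symmetric])
  then show ?thesis by (simp only: measure_empty)
qed

lemma renewal_prob_eq_sum: "v \<le> n \<Longrightarrow> (\<Sum>k\<le>n. regeneration_prob k v) = renewal_prob v"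
  unfolding renewal_prob_def
  by (rule sum.mono_neutral_right) (auto intro: regeneration_prob_eq_0)

lemma regeneration_prob_Suc:
  "regeneration_prob (Suc k) v = (\<Sum>i\<le>v. length_prob i * regeneration_prob k (v - i))"
proof -
  define B where "B i = {s \<in> space cycle_sequences. length (s (0::nat)) = i}" for i
  have "(\<lambda>s. length (s (0::nat))) \<in> cycle_sequences \<rightarrow>\<^sub>M count_space UNIV"
    by (rule measurable_compose[OF _ measurable_length_cycle[of S]])
      (rule measurable_component_singleton, simp)
  then have B: "B i \<in> sets cycle_sequences" for i unfolding B_def by measurable
  have in_B: "future k \<omega> \<in> B i \<longleftrightarrow> length (C (Suc k) \<omega>) = i" if "\<omega> \<in> space M" for \<omega> i k
    using measurable_space[OF future_measurable that] by (simp add: B_def future_def)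
  have "{\<omega> \<in> space M. T (Suc k) \<omega> = v}
      = (\<Union>i\<le>v. {\<omega> \<in> space M. T k \<omega> = v - i \<and> future k \<omega> \<in> B i})"
    using T_Suc[of _ k] in_B[of _ k] by auto
  also have "M.prob \<dots> = (\<Sum>i\<le>v. M.prob {\<omega> \<in> space M. T k \<omega> = v - i \<and> future k \<omega> \<in> B i})"
    using B by (intro M.finite_measure_finite_Union)
      (auto simp: disjoint_family_on_def in_B intro!: sets.sets_Collect)
  also have "\<dots> = (\<Sum>i\<le>v. length_prob i * regeneration_prob k (v - i))"
  proof (intro sum.cong refl)
    fix i
    have "{\<omega> \<in> space M. future 0 \<omega> \<in> B i} = {\<omega> \<in> space M. cycle_length T 1 \<omega> = i}"
      using in_B[of _ 0] by (auto simp: length_C)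
    then show "M.prob {\<omega> \<in> space M. T k \<omega> = v - i \<and> future k \<omega> \<in> B i}
        = length_prob i * regeneration_prob k (v - i)"
      unfolding prob_regeneration_future[OF B] length_prob_def by simp
  qed
  finally show ?thesis .
qed

lemma length_prob_0: "length_prob 0 = 0"
proof -
  have "{\<omega> \<in> space M. cycle_length T 1 \<omega> = 0} = {}"
    using length_C_pos[of _ 0] by (auto simp: length_C)
  then show ?thesis unfolding length_prob_def by (simp only: measure_empty)
qed

text \<open>A regeneration at \<open>v\<close> is either the initial one, \<open>T 0\<close>, or it ends a cycle of some length \<open>i\<close> that
  started at a regeneration at \<open>v - i\<close>.\<close>

lemma renewal_equation:
  "renewal_prob v = regeneration_prob 0 v + (\<Sum>i\<le>v. length_prob i * renewal_prob (v - i))"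
proof -
  have "(\<Sum>k<v. regeneration_prob (Suc k) v)
      = (\<Sum>i\<le>v. length_prob i * (\<Sum>k<v. regeneration_prob k (v - i)))"
    unfolding regeneration_prob_Suc sum_distrib_left by (rule sum.swap)
  also have "\<dots> = (\<Sum>i\<le>v. length_prob i * renewal_prob (v - i))"
  proof (intro sum.cong refl)
    fix i assume "i \<in> {..v}"
    show "length_prob i * (\<Sum>k<v. regeneration_prob k (v - i)) = length_prob i * renewal_prob (v - i)"
    proof (cases "i = 0")
      case False
      have "(\<Sum>k<v. regeneration_prob k (v - i)) = renewal_prob (v - i)"
        unfolding renewal_prob_def using False \<open>i \<in> {..v}\<close>
        by (intro sum.mono_neutral_right) (auto intro: regeneration_prob_eq_0)
      then show ?thesis by simp
    qed (simp add: length_prob_0)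
  qed
  finally show ?thesis
    unfolding renewal_prob_def[of v] by (simp add: sum.atMost_shift)
qed

lemma nat_valued_prob_sums:
  assumes "X \<in> M \<rightarrow>\<^sub>M count_space (UNIV :: nat set)"
  shows "(\<lambda>n. M.prob {\<omega> \<in> space M. X \<omega> = n}) sums 1"
proof -
  have "(\<lambda>n. M.prob {\<omega> \<in> space M. X \<omega> = n}) sums M.prob (\<Union>n. {\<omega> \<in> space M. X \<omega> = n})"
    by (rule M.finite_measure_UNION) (use assms in \<open>auto simp: disjoint_family_on_def\<close>)
  also have "(\<Union>n. {\<omega> \<in> space M. X \<omega> = n}) = space M" by auto
  finally show ?thesis by (simp add: M.prob_space)
qed

lemma prob_length_greater:
  "M.prob {\<omega> \<in> space M. k < cycle_length T 1 \<omega>} = 1 - (\<Sum>i\<le>k. length_prob i)"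
proof -
  have "(\<Sum>i\<le>k. length_prob i) = M.prob (\<Union>i\<le>k. {\<omega> \<in> space M. cycle_length T 1 \<omega> = i})"
    unfolding length_prob_def
    by (rule M.finite_measure_finite_Union[symmetric])
      (auto simp: disjoint_family_on_def simp del: One_nat_def)
  also have "(\<Union>i\<le>k. {\<omega> \<in> space M. cycle_length T 1 \<omega> = i}) = space M - {\<omega> \<in> space M. k < cycle_length T 1 \<omega>}"
    by auto
  also have "M.prob \<dots> = 1 - M.prob {\<omega> \<in> space M. k < cycle_length T 1 \<omega>}"
    by (rule M.prob_compl) measurable
  finally show ?thesis by simp
qed

end

locale aperiodic_regenerative_recursion = regenerative_recursion +
  assumes integrable_length: "integrable M (\<lambda>\<omega>. real (cycle_length T 1 \<omega>))"
    and aperiodic: "Gcd {n. M.prob {\<omega> \<in> space M. cycle_length T 1 \<omega> = n} > 0} = 1"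
begin

definition mean_length :: real where
  "mean_length = M.expectation (\<lambda>\<omega>. real (cycle_length T 1 \<omega>))"

lemma prob_length_greater_sums:
  "(\<lambda>k. M.prob {\<omega> \<in> space M. k < cycle_length T 1 \<omega>}) sums mean_length"
proof (subst sums_ennreal[symmetric])
  have "(\<Sum>k. emeasure M {\<omega> \<in> space M. k < cycle_length T 1 \<omega>}) = (\<integral>\<^sup>+\<omega>. of_nat (cycle_length T 1 \<omega>) \<partial>M)"
    by (rule nn_integral_nat_function[symmetric]) measurable
  also have "\<dots> = ennreal mean_length"
    unfolding mean_length_def using nn_integral_eq_integral[OF integrable_length]
    by (simp add: ennreal_of_nat_eq_real_of_nat)
  finally show "(\<lambda>k. ennreal (M.prob {\<omega> \<in> space M. k < cycle_length T 1 \<omega>})) sums ennreal mean_length"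
    using summable_sums[OF summableI, of "\<lambda>k. emeasure M {\<omega> \<in> space M. k < cycle_length T 1 \<omega>}"]
    by (simp add: M.emeasure_eq_measure)
qed (auto simp: mean_length_def)

lemma renewal_prob_tendsto: "renewal_prob \<longlonglongrightarrow> 1 / mean_length"
  and renewal_prob_le_1: "renewal_prob v \<le> 1"
proof -
  note * = discrete_renewal_theorem[where p=length_prob and d="regeneration_prob 0" and u=renewal_prob
      and \<mu>=mean_length, OF _ _ length_prob_0 _ _ _ _ _ renewal_equation]
  have "length_prob sums 1" unfolding length_prob_def by (rule nat_valued_prob_sums) measurable
  moreover have "regeneration_prob 0 sums 1" by (rule nat_valued_prob_sums) measurable
  moreover have "Gcd {n. 0 < length_prob n} = 1" using aperiodic by (simp add: length_prob_def)
  moreover have "(\<lambda>k. 1 - (\<Sum>i\<le>k. length_prob i)) sums mean_length"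
    using prob_length_greater_sums unfolding prob_length_greater .
  ultimately show "renewal_prob \<longlonglongrightarrow> 1 / mean_length" "renewal_prob v \<le> 1"
    using * by (simp_all add: length_prob_def renewal_prob_def sum_nonneg)
qed

lemma mean_length_ge_1: "1 \<le> mean_length"
proof -
  have "(\<integral>\<omega>. 1 \<partial>M) \<le> mean_length"
    unfolding mean_length_def
    by (rule integral_mono) (use integrable_length length_C_pos[of _ 0] in \<open>auto simp: length_C Suc_le_eq\<close>)
  then show ?thesis by (simp add: M.prob_space)
qed

end

section \<open>Restarting the recursion a fixed number of cycles earlier\<close>

context regenerative_recursion
begin

text \<open>Below, \<open>H l\<close> stands for an event about the position \<open>l\<close> of a cycle that is entered at a given
  value.  The event presupposes that the cycle reaches this position.\<close>

definition admissible :: "(nat \<Rightarrow> (real \<times> 'z list) set) \<Rightarrow> bool" where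
  "admissible H \<longleftrightarrow> (\<forall>l. H l \<in> sets (borel \<Otimes>\<^sub>M cycle_space S)) \<and> (\<forall>l. \<forall>p\<in>H l. l < length (snd p))"

text \<open>The event \<open>H\<close> at a time \<open>w\<close> counted from the beginning of a sequence of cycles, if that time
  falls into the cycle with index \<open>m\<close> and the recursion starts from \<open>y\<close> at time \<open>0\<close>.\<close>

definition window :: "real \<Rightarrow> nat \<Rightarrow> (nat \<Rightarrow> (real \<times> 'z list) set) \<Rightarrow> nat \<Rightarrow> (nat \<Rightarrow> 'z list) set" where
  "window y m H w = {s \<in> space cycle_sequences.
     cycles_time m s \<le> w \<and> (cycles_value m y s, s m) \<in> H (w - cycles_time m s)}"

text \<open>The recursion is restarted from \<open>y\<close> exactly \<open>m\<close> cycles before the cycle that contains \<open>t\<close>; \<open>H\<close>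
  is the event observed at time \<open>t\<close>.\<close>

definition restarted_event :: "real \<Rightarrow> nat \<Rightarrow> (nat \<Rightarrow> (real \<times> 'z list) set) \<Rightarrow> nat \<Rightarrow> 'w set" where
  "restarted_event y m H t = {\<omega> \<in> space M. \<exists>k. T (k + m) \<omega> \<le> t \<and>
     (cycles_value m y (future k \<omega>), C (Suc (k + m)) \<omega>) \<in> H (t - T (k + m) \<omega>)}"

abbreviation window_prob :: "real \<Rightarrow> nat \<Rightarrow> (nat \<Rightarrow> (real \<times> 'z list) set) \<Rightarrow> nat \<Rightarrow> real" where
  "window_prob y m H w \<equiv> M.prob {\<omega> \<in> space M. future 0 \<omega> \<in> window y m H w}"

lemma component_measurable: "(\<lambda>s. s j) \<in> cycle_sequences \<rightarrow>\<^sub>M cycle_space S"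
  by (rule measurable_component_singleton) simp

lemma window_measurable:
  assumes "admissible H"
  shows "window y m H w \<in> sets cycle_sequences"
proof -
  have V: "(\<lambda>s. (cycles_value m y s, s m)) \<in> cycle_sequences \<rightarrow>\<^sub>M borel \<Otimes>\<^sub>M cycle_space S"
    by (intro measurable_Pair measurable_cycles_value component_measurable)
  have t: "(\<lambda>s. cycles_time m s) \<in> cycle_sequences \<rightarrow>\<^sub>M count_space UNIV"
    by (rule measurable_cycles_time[where S=S]) (rule component_measurable)
  have 1: "(\<lambda>s. (cycles_value m y s, s m)) -` H l \<inter> space cycle_sequences \<in> sets cycle_sequences" for l
    using assms by (intro measurable_sets[OF V]) (auto simp: admissible_def)
  have 2: "(\<lambda>s. cycles_time m s) -` {j} \<inter> space cycle_sequences \<in> sets cycle_sequences" for j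
    by (intro measurable_sets[OF t]) auto
  have "(\<Union>j\<le>w. ((\<lambda>s. cycles_time m s) -` {j} \<inter> space cycle_sequences) \<inter>
      ((\<lambda>s. (cycles_value m y s, s m)) -` H (w - j) \<inter> space cycle_sequences)) \<in> sets cycle_sequences"
    by (intro sets.finite_UN sets.Int[OF 2 1]) simp
  also have "(\<Union>j\<le>w. ((\<lambda>s. cycles_time m s) -` {j} \<inter> space cycle_sequences) \<inter>
      ((\<lambda>s. (cycles_value m y s, s m)) -` H (w - j) \<inter> space cycle_sequences)) = window y m H w"
    by (auto simp: window_def)
  finally show ?thesis .
qed

lemma future_in_space: "\<omega> \<in> space M \<Longrightarrow> future k \<omega> \<in> space cycle_sequences"
  by (rule measurable_space[OF future_measurable])

text \<open>Here \<open>T k\<close> is the time of the restart and \<open>w\<close> the time elapsed between it and \<open>t\<close>.  In this form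
  each piece is an intersection of an event about \<open>T k\<close> and an event about the cycles after it.\<close>

lemma restarted_event_eq:
  "restarted_event y m H t
    = (\<Union>(k, w) \<in> {..t} \<times> {..t}. {\<omega> \<in> space M. T k \<omega> = t - w \<and> future k \<omega> \<in> window y m H w})"
proof (intro equalityI subsetI)
  fix \<omega> assume "\<omega> \<in> restarted_event y m H t"
  then obtain k where \<omega>: "\<omega> \<in> space M" and k: "T (k + m) \<omega> \<le> t"
    "(cycles_value m y (future k \<omega>), C (Suc (k + m)) \<omega>) \<in> H (t - T (k + m) \<omega>)"
    by (auto simp: restarted_event_def)
  have "k \<le> T k \<omega>" "T k \<omega> \<le> T (k + m) \<omega>" using le_T T_mono \<omega> by auto
  moreover have "future k \<omega> \<in> window y m H (t - T k \<omega>)"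
    using k future_in_space[OF \<omega>] T_add[OF \<omega>, of k m] by (simp add: window_def future_def[of k \<omega> m])
  ultimately show "\<omega> \<in> (\<Union>(k, w) \<in> {..t} \<times> {..t}.
      {\<omega> \<in> space M. T k \<omega> = t - w \<and> future k \<omega> \<in> window y m H w})"
    using k(1) \<omega> by (intro UN_I[of "(k, t - T k \<omega>)"]) auto
next
  fix \<omega> assume "\<omega> \<in> (\<Union>(k, w) \<in> {..t} \<times> {..t}.
      {\<omega> \<in> space M. T k \<omega> = t - w \<and> future k \<omega> \<in> window y m H w})"
  then obtain k w where \<omega>: "\<omega> \<in> space M" and k: "w \<le> t" "T k \<omega> = t - w" "future k \<omega> \<in> window y m H w"
    by auto
  then have "t - T (k + m) \<omega> = w - cycles_time m (future k \<omega>)" "T (k + m) \<omega> \<le> t"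
    using T_add[OF \<omega>, of k m] by (auto simp: window_def)
  then show "\<omega> \<in> restarted_event y m H t"
    using k \<omega> unfolding restarted_event_def by (auto simp: window_def future_def[of k \<omega> m] intro!: exI[of _ k])
qed

text \<open>The number \<open>k + m\<close> is determined by \<open>T (k + m) \<le> t < T (k + m + 1)\<close>, and then \<open>w = t - T k\<close>.\<close>

lemma restarted_pieces_disjoint:
  assumes "admissible H"
  shows "disjoint_family_on (\<lambda>(k, w). {\<omega> \<in> space M. T k \<omega> = t - w \<and> future k \<omega> \<in> window y m H w})
    ({..t} \<times> {..t})"
proof -
  have cover: "T (k + m) \<omega> \<le> t \<and> t < T (Suc (k + m)) \<omega>"
    if "\<omega> \<in> space M" "w \<le> t" "T k \<omega> = t - w" "future k \<omega> \<in> window y m H w" for \<omega> k w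
  proof -
    have "w - cycles_time m (future k \<omega>) < length (future k \<omega> m)" "cycles_time m (future k \<omega>) \<le> w"
      using that(4) assms by (auto simp: window_def admissible_def dest!: bspec)
    moreover have "T (k + m) \<omega> = t - w + cycles_time m (future k \<omega>)"
      "T (Suc (k + m)) \<omega> = T (k + m) \<omega> + length (future k \<omega> m)"
      using that T_add[of \<omega> k m] T_Suc[of \<omega> "k + m"] by (simp_all add: future_def[of k \<omega> m])
    ultimately show ?thesis using \<open>w \<le> t\<close> by arith
  qed
  have uniq: "k = k'" if "\<omega> \<in> space M" "T (k + m) \<omega> \<le> t" "t < T (Suc (k + m)) \<omega>"
    "T (k' + m) \<omega> \<le> t" "t < T (Suc (k' + m)) \<omega>" for k k' \<omega>
  proof (rule ccontr)
    assume "k \<noteq> k'"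
    then consider "Suc (k + m) \<le> k' + m" | "Suc (k' + m) \<le> k + m" by linarith
    then show False
      using T_mono[OF that(1), of "Suc (k + m)" "k' + m"] T_mono[OF that(1), of "Suc (k' + m)" "k + m"] that(2-)
      by cases auto
  qed
  show ?thesis
    unfolding disjoint_family_on_def
  proof (intro ballI impI equals0I)
    fix p p' \<omega>
    assume p: "p \<in> {..t} \<times> {..t}" "p' \<in> {..t} \<times> {..t}" "p \<noteq> p'"
      and "\<omega> \<in> (case p of (k, w) \<Rightarrow> {\<omega> \<in> space M. T k \<omega> = t - w \<and> future k \<omega> \<in> window y m H w})
        \<inter> (case p' of (k, w) \<Rightarrow> {\<omega> \<in> space M. T k \<omega> = t - w \<and> future k \<omega> \<in> window y m H w})"
    moreover obtain k w k' w' where pp: "p = (k, w)" "p' = (k', w')" by (cases p, cases p')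
    ultimately have \<omega>: "\<omega> \<in> space M" "w \<le> t" "T k \<omega> = t - w" "future k \<omega> \<in> window y m H w"
      "w' \<le> t" "T k' \<omega> = t - w'" "future k' \<omega> \<in> window y m H w'"
      by auto
    have "k = k'"
      using uniq[OF \<omega>(1)] cover[OF \<omega>(1-4)] cover[OF \<omega>(1,5-7)] by blast
    then have "w = w'" using \<omega>(2,3,5,6) by simp
    with \<open>k = k'\<close> p(3) pp show False by simp
  qed
qed

lemma restarted_piece_measurable:
  assumes "admissible H"
  shows "{\<omega> \<in> space M. T k \<omega> = v \<and> future k \<omega> \<in> window y m H w} \<in> M.events"
proof -
  have "{\<omega> \<in> space M. T k \<omega> = v} \<in> M.events" by measurable
  then have "{\<omega> \<in> space M. T k \<omega> = v} \<inter> (future k -` window y m H w \<inter> space M) \<in> M.events"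
    by (rule sets.Int) (rule measurable_sets[OF future_measurable window_measurable[OF assms]])
  also have "{\<omega> \<in> space M. T k \<omega> = v} \<inter> (future k -` window y m H w \<inter> space M)
      = {\<omega> \<in> space M. T k \<omega> = v \<and> future k \<omega> \<in> window y m H w}" by auto
  finally show ?thesis .
qed

lemma restarted_event_measurable: "admissible H \<Longrightarrow> restarted_event y m H t \<in> M.events"
  unfolding restarted_event_eq by (intro sets.finite_UN) (auto intro: restarted_piece_measurable)

lemma prob_restarted_event:
  assumes "admissible H"
  shows "M.prob (restarted_event y m H t) = (\<Sum>w\<le>t. window_prob y m H w * renewal_prob (t - w))"
proof -
  let ?E = "\<lambda>(k, w). {\<omega> \<in> space M. T k \<omega> = t - w \<and> future k \<omega> \<in> window y m H w}"
  note W = window_measurable[OF assms, of y m]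
  have "?E ` ({..t} \<times> {..t}) \<subseteq> M.events"
    using restarted_piece_measurable[OF assms] by auto
  then have "M.prob (restarted_event y m H t) = (\<Sum>p\<in>{..t} \<times> {..t}. M.prob (?E p))"
    unfolding restarted_event_eq
    by (intro M.finite_measure_finite_Union restarted_pieces_disjoint assms) auto
  also have "\<dots> = (\<Sum>p\<in>{..t} \<times> {..t}. (\<lambda>(k, w). regeneration_prob k (t - w) * window_prob y m H w) p)"
    by (intro sum.cong refl) (auto simp: prob_regeneration_future[OF W])
  also have "\<dots> = (\<Sum>k\<le>t. \<Sum>w\<le>t. regeneration_prob k (t - w) * window_prob y m H w)"
    by (simp add: sum.cartesian_product)
  also have "\<dots> = (\<Sum>w\<le>t. \<Sum>k\<le>t. regeneration_prob k (t - w) * window_prob y m H w)"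
    by (rule sum.swap)
  also have "\<dots> = (\<Sum>w\<le>t. window_prob y m H w * renewal_prob (t - w))"
    by (simp add: sum_distrib_right[symmetric] renewal_prob_eq_sum mult.commute)
  finally show ?thesis .
qed

text \<open>Summing over all times \<open>w\<close> amounts to summing over all positions \<open>l\<close> in the cycle with index \<open>m\<close>,
  because the beginning of that cycle only shifts the index.  This removes the dependence between
  the length of the first \<open>m\<close> cycles and the value reached.\<close>

lemma suminf_window:
  assumes "admissible H"
  shows "(\<Sum>w. ennreal (window_prob y m H w)) = (\<Sum>l. ennreal (measure (kernel_power m y \<Otimes>\<^sub>M Q) (H l)))"
proof -
  let ?A = "\<lambda>w. {\<omega> \<in> space M. future 0 \<omega> \<in> window y m H w}"
  let ?B = "\<lambda>l. {\<omega> \<in> space M. (cycles_value m y (future 0 \<omega>), future 0 \<omega> m) \<in> H l}"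
  have A: "?A w \<in> M.events" for w
    using measurable_sets[OF future_measurable window_measurable[OF assms], of 0 y m w]
    by (simp add: vimage_def Int_def conj_commute)
  have "(\<lambda>\<omega>. (cycles_value m y (future 0 \<omega>), future 0 \<omega> m)) \<in> M \<rightarrow>\<^sub>M borel \<Otimes>\<^sub>M cycle_space S"
    by (intro measurable_Pair cycles_value_future_measurable) (simp add: future_def)
  from measurable_sets[OF this]
  have "(\<lambda>\<omega>. (cycles_value m y (future 0 \<omega>), future 0 \<omega> m)) -` H l \<inter> space M \<in> M.events" for l
    using assms unfolding admissible_def by blast
  moreover have "(\<lambda>\<omega>. (cycles_value m y (future 0 \<omega>), future 0 \<omega> m)) -` H l \<inter> space M = ?B l" for l
    by auto
  ultimately have B: "?B l \<in> M.events" for l by metis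
  have "(\<Sum>w. ennreal (M.prob (?A w))) = (\<Sum>w. \<integral>\<^sup>+\<omega>. indicator (?A w) \<omega> \<partial>M)"
    using A by (simp add: M.emeasure_eq_measure)
  also have "\<dots> = (\<integral>\<^sup>+\<omega>. (\<Sum>w. indicator (?A w) \<omega>) \<partial>M)"
    by (rule nn_integral_suminf[symmetric]) (use A in auto)
  also have "\<dots> = (\<integral>\<^sup>+\<omega>. (\<Sum>l. indicator (?B l) \<omega>) \<partial>M)"
  proof (rule nn_integral_cong)
    fix \<omega> assume \<omega>: "\<omega> \<in> space M"
    have "(\<Sum>l. indicator (?B l) \<omega> :: ennreal) = (\<Sum>w. if cycles_time m (future 0 \<omega>) \<le> w
        then indicator (?B (w - cycles_time m (future 0 \<omega>))) \<omega> else 0)"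
      by (rule suminf_delay_ennreal[symmetric])
    also have "\<dots> = (\<Sum>w. indicator (?A w) \<omega>)"
      using \<omega> future_in_space[OF \<omega>, of 0]
      by (intro suminf_cong) (simp add: window_def indicator_def)
    finally show "(\<Sum>w. indicator (?A w) \<omega> :: ennreal) = (\<Sum>l. indicator (?B l) \<omega>)" ..
  qed
  also have "\<dots> = (\<Sum>l. \<integral>\<^sup>+\<omega>. indicator (?B l) \<omega> \<partial>M)"
    by (rule nn_integral_suminf) (use B in auto)
  also have "\<dots> = (\<Sum>l. ennreal (M.prob (?B l)))"
    using B by (simp add: M.emeasure_eq_measure)
  also have "\<dots> = (\<Sum>l. ennreal (measure (kernel_power m y \<Otimes>\<^sub>M Q) (H l)))"
    using assms by (simp add: prob_value_cycle admissible_def)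
  finally show ?thesis .
qed

text \<open>The largest admissible family; it provides the dominating sequence.\<close>

definition longer :: "nat \<Rightarrow> (real \<times> 'z list) set" where
  "longer l = {p \<in> space (borel \<Otimes>\<^sub>M cycle_space S). l < length (snd p)}"

lemma admissible_longer: "admissible longer"
proof -
  have "(\<lambda>p. length (snd p)) \<in> borel \<Otimes>\<^sub>M cycle_space S \<rightarrow>\<^sub>M count_space UNIV" by measurable
  then show ?thesis unfolding admissible_def longer_def by auto
qed

lemma admissible_subset_longer: "admissible H \<Longrightarrow> H l \<subseteq> longer l"
  using sets.sets_into_space unfolding admissible_def longer_def by blast

lemma measure_length_greater:
  "measure Q {\<xi> \<in> space Q. l < length \<xi>} = M.prob {\<omega> \<in> space M. l < cycle_length T 1 \<omega>}"
proof -
  have "{\<xi> \<in> space (cycle_space S). l < length \<xi>} \<in> sets (cycle_space S)" by measurable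
  then show ?thesis by (simp only: measure_Q_eq length_C)
qed

lemma measure_longer:
  assumes "real_distribution \<nu>"
  shows "measure (\<nu> \<Otimes>\<^sub>M Q) (longer l) = M.prob {\<omega> \<in> space M. l < cycle_length T 1 \<omega>}"
proof -
  interpret \<nu>: real_distribution \<nu> by fact
  have "longer l = space \<nu> \<times> {\<xi> \<in> space Q. l < length \<xi>}"
    by (auto simp: longer_def space_pair_measure space_Q)
  moreover have "{\<xi> \<in> space Q. l < length \<xi>} \<in> sets Q" by measurable
  ultimately have "measure (\<nu> \<Otimes>\<^sub>M Q) (longer l) = measure \<nu> (space \<nu>) * measure Q {\<xi> \<in> space Q. l < length \<xi>}"
    by (simp add: measure_def Q.emeasure_pair_measure_Times enn2real_mult)
  then show ?thesis by (simp add: \<nu>.prob_space measure_length_greater del: \<nu>.space_eq_univ)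
qed

lemma measure_admissible_le:
  assumes "real_distribution \<nu>" "admissible H"
  shows "measure (\<nu> \<Otimes>\<^sub>M Q) (H l) \<le> M.prob {\<omega> \<in> space M. l < cycle_length T 1 \<omega>}"
proof -
  interpret \<nu>: real_distribution \<nu> by fact
  interpret P: pair_prob_space \<nu> Q ..
  have "sets (\<nu> \<Otimes>\<^sub>M Q) = sets (borel \<Otimes>\<^sub>M cycle_space S)"
    by (intro sets_pair_measure_cong) (simp_all add: sets_Q)
  then show ?thesis
    unfolding measure_longer[OF assms(1), symmetric]
    using admissible_longer admissible_subset_longer[OF assms(2)]
    by (intro P.finite_measure_mono) (auto simp: admissible_def)
qed

end

context aperiodic_regenerative_recursion
begin

lemma summable_admissible:
  assumes "real_distribution \<nu>" "admissible H"
  shows "summable (\<lambda>l. measure (\<nu> \<Otimes>\<^sub>M Q) (H l))"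
  by (rule summable_comparison_test[OF _ sums_summable[OF prob_length_greater_sums]])
    (use measure_admissible_le[OF assms] in auto)

lemma window_prob_sums:
  assumes "admissible H"
  shows "window_prob y m H sums (\<Sum>l. measure (kernel_power m y \<Otimes>\<^sub>M Q) (H l))"
proof -
  have s: "summable (\<lambda>l. measure (kernel_power m y \<Otimes>\<^sub>M Q) (H l))"
    by (rule summable_admissible[OF real_distribution_kernel_power assms])
  have "(\<Sum>w. ennreal (window_prob y m H w)) = ennreal (\<Sum>l. measure (kernel_power m y \<Otimes>\<^sub>M Q) (H l))"
    using s by (simp only: suminf_window[OF assms] suminf_ennreal2[OF measure_nonneg])
  then show ?thesis
    using summable_sums[OF summableI, of "\<lambda>w. ennreal (window_prob y m H w)"]
    by (simp add: suminf_nonneg[OF s])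
qed

lemma prob_restarted_event_tendsto:
  obtains \<kappa> where "\<kappa> \<longlonglongrightarrow> 0"
    "\<And>H t. admissible H \<Longrightarrow> \<bar>M.prob (restarted_event y m H t)
       - (\<Sum>l. measure (kernel_power m y \<Otimes>\<^sub>M Q) (H l)) / mean_length\<bar> \<le> \<kappa> t"
proof -
  let ?g = "window_prob y m longer"
  have nonneg: "0 \<le> renewal_prob n" for n by (simp add: renewal_prob_def sum_nonneg)
  have "summable ?g" using window_prob_sums[OF admissible_longer] by (rule sums_summable)
  then obtain \<kappa> where \<kappa>: "\<kappa> \<longlonglongrightarrow> 0"
    "\<And>q t. (\<And>w. 0 \<le> q w) \<Longrightarrow> (\<And>w. q w \<le> ?g w) \<Longrightarrow>
       \<bar>(\<Sum>w\<le>t. q w * renewal_prob (t - w)) - (\<Sum>w. q w) * (1 / mean_length)\<bar> \<le> \<kappa> t"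
    by (rule convolution_uniform_tendsto[OF renewal_prob_tendsto nonneg renewal_prob_le_1 _ measure_nonneg]) blast
  show thesis
  proof (rule that[OF \<kappa>(1)])
    fix H t assume H: "admissible H"
    have "window y m H w \<subseteq> window y m longer w" for w
      using admissible_subset_longer[OF H] by (auto simp: window_def)
    moreover have "{\<omega> \<in> space M. future 0 \<omega> \<in> window y m longer w} \<in> M.events" for w
      using measurable_sets[OF future_measurable window_measurable[OF admissible_longer], of 0 y m w]
      by (simp add: vimage_def Int_def conj_commute)
    ultimately have "window_prob y m H w \<le> ?g w" for w
      by (intro M.finite_measure_mono) auto
    from \<kappa>(2)[OF measure_nonneg this, of t]
    show "\<bar>M.prob (restarted_event y m H t)
        - (\<Sum>l. measure (kernel_power m y \<Otimes>\<^sub>M Q) (H l)) / mean_length\<bar> \<le> \<kappa> t"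
      by (simp add: prob_restarted_event[OF H] sums_unique[OF window_prob_sums[OF H], symmetric])
  qed
qed

end

section \<open>The stationary distribution and the limit theorem\<close>

lemma SUP_between:
  fixes \<phi> :: "'i \<Rightarrow> real"
  assumes "I \<noteq> {}" "\<And>i. i \<in> I \<Longrightarrow> 0 \<le> \<phi> i" "\<And>i. i \<in> I \<Longrightarrow> \<phi> i \<le> e"
  shows "0 \<le> (SUP i\<in>I. \<phi> i)" and "(SUP i\<in>I. \<phi> i) \<le> e"
proof -
  obtain i where "i \<in> I" using assms(1) by blast
  moreover have "bdd_above (\<phi> ` I)" using assms(3) by (auto simp: bdd_above_def)
  ultimately show "0 \<le> (SUP i\<in>I. \<phi> i)" using assms(2) cSUP_upper2 by metis
  show "(SUP i\<in>I. \<phi> i) \<le> e" by (rule cSUP_least[OF assms(1,3)])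
qed

lemma tendsto_0I_upto:
  fixes \<phi> :: "nat \<Rightarrow> real"
  assumes "\<And>e. 0 < e \<Longrightarrow> eventually (\<lambda>t. 0 \<le> \<phi> t \<and> \<phi> t \<le> e) sequentially"
  shows "\<phi> \<longlonglongrightarrow> 0"
proof (rule tendstoI)
  fix e :: real assume "0 < e"
  then have "eventually (\<lambda>t. 0 \<le> \<phi> t \<and> \<phi> t \<le> e / 2) sequentially" by (intro assms) simp
  then show "eventually (\<lambda>t. dist (\<phi> t) 0 < e) sequentially"
    by eventually_elim (use \<open>0 < e\<close> in \<open>auto simp: dist_real_def\<close>)
qed

context regenerative_recursion
begin

text \<open>The event in the definition of the stationary distribution, as a condition on the value at the
  beginning of a cycle and on the cycle.\<close>

definition hit :: "(real \<times> 'z) set \<Rightarrow> nat \<Rightarrow> (real \<times> 'z list) set" where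
  "hit E l = {p \<in> space (borel \<Otimes>\<^sub>M cycle_space S). l < length (snd p) \<and>
     (flow l (fst p) (snd p), nth_or z0 (snd p) l) \<in> E}"

lemma admissible_hit:
  assumes "E \<in> sets (borel \<Otimes>\<^sub>M S)"
  shows "admissible (hit E)"
  unfolding admissible_def
proof (intro conjI allI)
  fix l
  let ?N = "borel \<Otimes>\<^sub>M cycle_space S :: (real \<times> 'z list) measure"
  have "(\<lambda>p. nth_or z0 (snd p) l) \<in> ?N \<rightarrow>\<^sub>M S"
    by (rule measurable_compose[OF measurable_snd measurable_nth_or[OF z0]])
  then have "(\<lambda>p. (flow l (fst p) (snd p), nth_or z0 (snd p) l)) \<in> ?N \<rightarrow>\<^sub>M borel \<Otimes>\<^sub>M S"
    by (intro measurable_Pair measurable_flow)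
  from measurable_sets[OF this assms] admissible_longer
  have "longer l \<inter> ((\<lambda>p. (flow l (fst p) (snd p), nth_or z0 (snd p) l)) -` E \<inter> space ?N) \<in> sets ?N"
    unfolding admissible_def by blast
  also have "longer l \<inter> ((\<lambda>p. (flow l (fst p) (snd p), nth_or z0 (snd p) l)) -` E \<inter> space ?N) = hit E l"
    by (auto simp: longer_def hit_def)
  finally show "hit E l \<in> sets ?N" .
qed (auto simp: hit_def)

text \<open>The product space of \<open>stationary_prob\<close> carries the whole regenerative sequence, but the event
  depends on the first cycle only.  The condition \<open>fst p \<in> {a..b}\<close>, under which the clamped flow
  is the original recursion, has probability one.\<close>

lemma prob_hit:
  assumes \<pi>: "distribution_on a b \<pi>" and E: "E \<in> sets (borel \<Otimes>\<^sub>M S)"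
  shows "\<P>(p in \<pi> \<Otimes>\<^sub>M M. fst p \<in> {a..b} \<and> cycle_length T 1 (snd p) > l \<and>
      (iterate f l (fst p) (\<lambda>s. Z (T 0 (snd p) + s) (snd p)), Z (T 0 (snd p) + l) (snd p)) \<in> E)
    = measure (\<pi> \<Otimes>\<^sub>M Q) (hit E l)"
proof -
  interpret \<pi>: real_distribution \<pi> using \<pi> by (simp add: distribution_on_def)
  interpret P: pair_prob_space \<pi> M ..
  let ?g = "\<lambda>p. (fst p, C 1 (snd p))"
  let ?A = "{p \<in> space (\<pi> \<Otimes>\<^sub>M M). ?g p \<in> hit E l}"
  have sets_\<pi>: "sets \<pi> = sets borel" by simp
  have g: "?g \<in> \<pi> \<Otimes>\<^sub>M M \<rightarrow>\<^sub>M borel \<Otimes>\<^sub>M cycle_space S"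
    by (intro measurable_Pair measurable_compose[OF measurable_snd C_measurable])
      (simp add: measurable_cong_sets[OF refl sets_\<pi>[symmetric]])
  have "\<pi> \<Otimes>\<^sub>M Q = distr \<pi> borel (\<lambda>x. x) \<Otimes>\<^sub>M distr M (cycle_space S) (C 1)"
    using distr_id2[OF sets_\<pi>[symmetric]] by (simp add: Q_def)
  also have "\<dots> = distr (\<pi> \<Otimes>\<^sub>M M) (borel \<Otimes>\<^sub>M cycle_space S) ?g"
    by (subst pair_measure_distr)
      (use prob_space_Q in \<open>auto simp: Q_def prob_space_imp_sigma_finite case_prod_beta'
         measurable_cong_sets[OF sets_\<pi> refl]\<close>)
  finally have Q: "\<pi> \<Otimes>\<^sub>M Q = distr (\<pi> \<Otimes>\<^sub>M M) (borel \<Otimes>\<^sub>M cycle_space S) ?g" .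
  have H: "hit E l \<in> sets (borel \<Otimes>\<^sub>M cycle_space S)"
    using admissible_hit[OF E] by (simp add: admissible_def)
  have A: "?A = ?g -` hit E l \<inter> space (\<pi> \<Otimes>\<^sub>M M)" by auto
  have A_meas: "?A \<in> P.events" unfolding A by (rule measurable_sets[OF g H])
  have B: "{a..b} \<times> space M \<in> P.events" by auto
  have "P.prob ({a..b} \<times> space M) = 1"
    using \<pi> by (simp add: distribution_on_def measure_def M.emeasure_pair_measure_Times enn2real_mult
        M.emeasure_space_1)
  then have AE: "AE p in \<pi> \<Otimes>\<^sub>M M. p \<in> {a..b} \<times> space M" by (rule P.AE_prob_1)
  have "{p \<in> space (\<pi> \<Otimes>\<^sub>M M). fst p \<in> {a..b} \<and> cycle_length T 1 (snd p) > l \<and>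
      (iterate f l (fst p) (\<lambda>s. Z (T 0 (snd p) + s) (snd p)), Z (T 0 (snd p) + l) (snd p)) \<in> E}
      = ?A \<inter> ({a..b} \<times> space M)"
  proof -
    have "(fst p \<in> {a..b} \<and> cycle_length T 1 (snd p) > l \<and>
        (iterate f l (fst p) (\<lambda>s. Z (T 0 (snd p) + s) (snd p)), Z (T 0 (snd p) + l) (snd p)) \<in> E)
        \<longleftrightarrow> ?g p \<in> hit E l \<and> p \<in> {a..b} \<times> space M"
      if p: "p \<in> space (\<pi> \<Otimes>\<^sub>M M)" for p
    proof (cases "fst p \<in> {a..b} \<and> l < length (C 1 (snd p))")
      case True
      have "snd p \<in> space M" using p by (auto simp: space_pair_measure)
      then show ?thesis
        using True iterate_within_cycle[of l 0 "snd p" "fst p"] nth_C[of l 0 "snd p"] C_in[of "snd p" 1]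
        by (auto simp: hit_def space_pair_measure length_C mem_Times_iff)
    next
      case False
      then show ?thesis by (auto simp: hit_def length_C)
    qed
    then show ?thesis by blast
  qed
  also have "P.prob (?A \<inter> ({a..b} \<times> space M)) = P.prob ?A"
    by (rule P.finite_measure_eq_AE) (use AE A_meas B in auto)
  also have "\<dots> = measure (\<pi> \<Otimes>\<^sub>M Q) (hit E l)"
    unfolding Q A by (rule measure_distr[OF g H, symmetric])
  finally show ?thesis .
qed

lemma recursion_measurable:
  assumes "x \<in> {a..b}"
  shows "recursion f Z x t \<in> M \<rightarrow>\<^sub>M borel"
proof -
  have "recursion f Z x t \<in> M \<rightarrow>\<^sub>M restrict_space borel {a..b}"
  proof (induction t)
    case 0
    then show ?case using assms by (simp add: measurable_restrict_space2_iff)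
  next
    case (Suc t)
    from measurable_compose[OF measurable_Pair[OF Suc.IH Z_measurable[of t]] f_measurable]
    show ?case by simp
  qed
  then show ?thesis by (simp add: measurable_restrict_space2_iff)
qed

lemma recursion_cycle_decomposition:
  assumes \<omega>: "\<omega> \<in> space M" and x: "x \<in> {a..b}"
    and k: "T (k + m) \<omega> \<le> t" "t < T (Suc (k + m)) \<omega>"
  defines "l \<equiv> t - T (k + m) \<omega>" and "\<xi> \<equiv> C (Suc (k + m)) \<omega>"
  shows "l < length \<xi>" and "Z t \<omega> = nth_or z0 \<xi> l"
    and "recursion f Z x t \<omega> = flow l (cycles_value m (recursion f Z x (T k \<omega>) \<omega>) (future k \<omega>)) \<xi>"
proof -
  have t: "t = T (k + m) \<omega> + l" using k by (simp add: l_def)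
  show l: "l < length \<xi>" using k T_Suc[OF \<omega>, of "k + m"] by (simp add: l_def \<xi>_def)
  show "Z t \<omega> = nth_or z0 \<xi> l" using l by (simp add: \<xi>_def nth_C t)
  have "recursion f Z x t \<omega> = flow l (recursion f Z x (T (k + m) \<omega>) \<omega>) \<xi>"
    unfolding t \<xi>_def by (rule recursion_after_regeneration[OF \<omega> x]) (use l in \<open>simp add: \<xi>_def\<close>)
  then show "recursion f Z x t \<omega> = flow l (cycles_value m (recursion f Z x (T k \<omega>) \<omega>) (future k \<omega>)) \<xi>"
    by (simp add: recursion_at_regeneration[OF \<omega> x])
qed

lemma restarted_hit_iff:
  assumes \<omega>: "\<omega> \<in> space M" and k: "T (k + m) \<omega> \<le> t"
  shows "(cycles_value m y (future k \<omega>), C (Suc (k + m)) \<omega>) \<in> hit ({..r} \<times> A) (t - T (k + m) \<omega>)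
    \<longleftrightarrow> t < T (Suc (k + m)) \<omega> \<and> Z t \<omega> \<in> A \<and>
      flow (t - T (k + m) \<omega>) (cycles_value m y (future k \<omega>)) (C (Suc (k + m)) \<omega>) \<le> r"
proof (cases "t < T (Suc (k + m)) \<omega>")
  case True
  then have "t - T (k + m) \<omega> < length (C (Suc (k + m)) \<omega>)"
    using k T_Suc[OF \<omega>, of "k + m"] by simp
  then show ?thesis
    using True k C_in[OF \<omega>] nth_C[of "t - T (k + m) \<omega>" "k + m" \<omega>]
    by (auto simp: hit_def space_pair_measure simp del: in_lists_conv_set)
next
  case False
  then show ?thesis using k T_Suc[OF \<omega>, of "k + m"] by (auto simp: hit_def)
qed

text \<open>Restarting from \<open>a\<close> makes the value at time \<open>t\<close> smaller.  The condition \<open>T m \<le> t\<close> makes sure that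
  there are \<open>m\<close> complete cycles to go back.\<close>

lemma subset_restarted_event:
  assumes x: "x \<in> {a..b}"
  shows "{\<omega> \<in> space M. T m \<omega> \<le> t \<and> recursion f Z x t \<omega> \<le> r \<and> Z t \<omega> \<in> A}
    \<subseteq> restarted_event a m (hit ({..r} \<times> A)) t"
proof
  fix \<omega> assume "\<omega> \<in> {\<omega> \<in> space M. T m \<omega> \<le> t \<and> recursion f Z x t \<omega> \<le> r \<and> Z t \<omega> \<in> A}"
  then have \<omega>: "\<omega> \<in> space M" and m: "T m \<omega> \<le> t" and rA: "recursion f Z x t \<omega> \<le> r" "Z t \<omega> \<in> A"
    by auto
  have bound: "\<forall>k. T (k + m) \<omega> \<le> t \<longrightarrow> k \<le> t"
    using le_T[OF \<omega>] by (meson le_add1 le_trans)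
  define k where "k = (GREATEST k. T (k + m) \<omega> \<le> t)"
  have k: "T (k + m) \<omega> \<le> t"
    unfolding k_def by (rule GreatestI_nat[where k=0 and b=t]) (use m bound in auto)
  have greatest: "j \<le> k" if "T (j + m) \<omega> \<le> t" for j
    unfolding k_def using that bound by (intro Greatest_le_nat[where b=t]) auto
  have k': "t < T (Suc (k + m)) \<omega>"
  proof (rule ccontr)
    assume "\<not> t < T (Suc (k + m)) \<omega>"
    then have "Suc k \<le> k" by (intro greatest) simp
    then show False by simp
  qed
  have "cycles_value m a (future k \<omega>) \<le> cycles_value m (recursion f Z x (T k \<omega>) \<omega>) (future k \<omega>)"
    using recursion_in[OF \<omega> x] future_in[OF \<omega>] by (intro cycles_value_mono) auto
  from flow_mono[OF C_in[OF \<omega>] this]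
  have "flow (t - T (k + m) \<omega>) (cycles_value m a (future k \<omega>)) (C (Suc (k + m)) \<omega>) \<le> r"
    using rA(1) recursion_cycle_decomposition(3)[OF \<omega> x k k'] by (metis order_trans)
  then have "(cycles_value m a (future k \<omega>), C (Suc (k + m)) \<omega>) \<in> hit ({..r} \<times> A) (t - T (k + m) \<omega>)"
    using restarted_hit_iff[OF \<omega> k] k' rA(2) by simp
  then show "\<omega> \<in> restarted_event a m (hit ({..r} \<times> A)) t"
    unfolding restarted_event_def using \<omega> k by blast
qed

text \<open>Restarting from \<open>b\<close> makes the value at time \<open>t\<close> larger.\<close>

lemma restarted_event_subset:
  assumes x: "x \<in> {a..b}"
  shows "restarted_event b m (hit ({..r} \<times> A)) t
    \<subseteq> {\<omega> \<in> space M. recursion f Z x t \<omega> \<le> r \<and> Z t \<omega> \<in> A}"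
proof
  fix \<omega> assume "\<omega> \<in> restarted_event b m (hit ({..r} \<times> A)) t"
  then obtain k where \<omega>: "\<omega> \<in> space M" and k: "T (k + m) \<omega> \<le> t"
    "(cycles_value m b (future k \<omega>), C (Suc (k + m)) \<omega>) \<in> hit ({..r} \<times> A) (t - T (k + m) \<omega>)"
    by (auto simp: restarted_event_def)
  then have k': "t < T (Suc (k + m)) \<omega>" "Z t \<omega> \<in> A"
    "flow (t - T (k + m) \<omega>) (cycles_value m b (future k \<omega>)) (C (Suc (k + m)) \<omega>) \<le> r"
    using restarted_hit_iff[OF \<omega> k(1)] by auto
  have "cycles_value m (recursion f Z x (T k \<omega>) \<omega>) (future k \<omega>) \<le> cycles_value m b (future k \<omega>)"
    using recursion_in[OF \<omega> x] future_in[OF \<omega>] by (intro cycles_value_mono) auto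
  from flow_mono[OF C_in[OF \<omega>] this]
  have "recursion f Z x t \<omega> \<le> r"
    using k'(3) recursion_cycle_decomposition(3)[OF \<omega> x k(1) k'(1)] by (metis order_trans)
  then show "\<omega> \<in> {\<omega> \<in> space M. recursion f Z x t \<omega> \<le> r \<and> Z t \<omega> \<in> A}"
    using \<omega> k'(2) by simp
qed

lemma prob_late_regeneration: "(\<lambda>t. M.prob {\<omega> \<in> space M. t < T m \<omega>}) \<longlonglongrightarrow> 0"
proof -
  have "(\<lambda>t. M.prob {\<omega> \<in> space M. t < T m \<omega>}) \<longlonglongrightarrow> M.prob (\<Inter>t. {\<omega> \<in> space M. t < T m \<omega>})"
    by (rule M.finite_Lim_measure_decseq) (auto simp: decseq_def)
  also have "(\<Inter>t. {\<omega> \<in> space M. t < T m \<omega>}) = {}" by auto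
  finally show ?thesis by simp
qed

end

context aperiodic_regenerative_recursion
begin

text \<open>For \<open>l\<close> fixed, only the cycles longer than \<open>l\<close> contribute to the difference; their probabilities
  add up to the mean cycle length.\<close>

lemma suminf_admissible_diff:
  assumes \<nu>: "real_distribution \<nu>" "real_distribution \<nu>'" and \<delta>: "\<And>r. \<bar>cdf \<nu> r - cdf \<nu>' r\<bar> \<le> \<delta>"
    and H: "admissible H"
    and down: "\<And>l \<xi> x y. \<xi> \<in> lists (space S) \<Longrightarrow> (y, \<xi>) \<in> H l \<Longrightarrow> x \<le> y \<Longrightarrow> (x, \<xi>) \<in> H l"
  shows "\<bar>(\<Sum>l. measure (\<nu> \<Otimes>\<^sub>M Q) (H l)) - (\<Sum>l. measure (\<nu>' \<Otimes>\<^sub>M Q) (H l))\<bar> \<le> \<delta> * mean_length"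
proof -
  let ?h = "\<lambda>l. measure (\<nu> \<Otimes>\<^sub>M Q) (H l) - measure (\<nu>' \<Otimes>\<^sub>M Q) (H l)"
  have bound: "\<bar>?h l\<bar> \<le> \<delta> * M.prob {\<omega> \<in> space M. l < cycle_length T 1 \<omega>}" for l
    unfolding measure_length_greater[symmetric]
  proof (rule product_down_closed_measure_diff[OF \<nu> prob_space_Q \<delta>])
    show "H l \<in> sets (borel \<Otimes>\<^sub>M Q)"
      using H by (simp only: sets_pair_measure_cong[OF refl sets_Q] admissible_def)
    show "{\<xi> \<in> space Q. l < length \<xi>} \<in> sets Q" by measurable
    show "(x, \<xi>) \<in> H l" if "\<xi> \<in> space Q" "(y, \<xi>) \<in> H l" "x \<le> y" for \<xi> x y
      using that down by (simp add: space_Q)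
    show "(\<forall>y. (y, \<xi>) \<in> H l) \<or> (\<forall>y. (y, \<xi>) \<notin> H l)"
      if "\<xi> \<in> space Q" "\<xi> \<notin> {\<xi> \<in> space Q. l < length \<xi>}" for \<xi>
      using that H by (force simp: admissible_def)
  qed
  have s: "(\<lambda>l. \<delta> * M.prob {\<omega> \<in> space M. l < cycle_length T 1 \<omega>}) sums (\<delta> * mean_length)"
    by (intro sums_mult prob_length_greater_sums)
  have abs: "summable (\<lambda>l. \<bar>?h l\<bar>)"
    by (rule summable_comparison_test[OF _ sums_summable[OF s]]) (use bound in auto)
  have "(\<Sum>l. measure (\<nu> \<Otimes>\<^sub>M Q) (H l)) - (\<Sum>l. measure (\<nu>' \<Otimes>\<^sub>M Q) (H l)) = (\<Sum>l. ?h l)"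
    by (intro suminf_diff summable_admissible \<nu> H)
  moreover have "\<bar>\<Sum>l. ?h l\<bar> \<le> (\<Sum>l. \<bar>?h l\<bar>)" by (rule summable_rabs[OF abs])
  moreover have "\<dots> \<le> \<delta> * mean_length"
    using suminf_le[OF bound abs sums_summable[OF s]] sums_unique[OF s] by simp
  ultimately show ?thesis by linarith
qed

lemma stationary_prob_eq:
  assumes "distribution_on a b \<pi>" "E \<in> sets (borel \<Otimes>\<^sub>M S)"
  shows "stationary_prob M f Z T a b \<pi> E = (\<Sum>l. measure (\<pi> \<Otimes>\<^sub>M Q) (hit E l)) / mean_length"
  using prob_hit[OF assms] by (simp add: stationary_prob_def mean_length_def)

text \<open>Given \<open>e\<close>, a number \<open>m\<close> of cycles is fixed for which the laws of the chain started at \<open>a\<close> and at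
  \<open>b\<close> are within \<open>e / 3\<close> of \<open>\<pi>\<close>.  For large \<open>t\<close> the error in the renewal limit and the probability
  that \<open>m\<close> complete cycles are not yet available are below \<open>e / 3\<close> each.\<close>

lemma uniform_convergence:
  assumes \<pi>: "distribution_on a b \<pi>" and \<rho>: "0 \<le> \<rho>" "\<rho> < 1"
    and rate: "\<And>m y r. \<bar>cdf (kernel_power m y) r - cdf \<pi> r\<bar> \<le> \<rho> ^ m"
    and x: "x \<in> {a..b}" and "0 < e"
  shows "\<forall>\<^sub>F t in sequentially. \<forall>r. \<forall>A\<in>sets S.
     \<bar>\<P>(\<omega> in M. recursion f Z x t \<omega> \<le> r \<and> Z t \<omega> \<in> A)
       - stationary_prob M f Z T a b \<pi> ({..r} \<times> A)\<bar> \<le> e"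
proof -
  interpret \<pi>: real_distribution \<pi> using \<pi> by (simp add: distribution_on_def)
  have "(\<lambda>m. \<rho> ^ m) \<longlonglongrightarrow> 0" using \<rho> by (intro LIMSEQ_power_zero) auto
  from order_tendstoD(2)[OF this, of "e / 3"] \<open>0 < e\<close>
  obtain m where m: "\<rho> ^ m < e / 3" by (auto simp: eventually_sequentially)
  let ?G = "\<lambda>y H. (\<Sum>l. measure (kernel_power m y \<Otimes>\<^sub>M Q) (H l)) / mean_length"
  obtain \<kappa>a where \<kappa>a: "\<kappa>a \<longlonglongrightarrow> 0"
    "\<And>H t. admissible H \<Longrightarrow> \<bar>M.prob (restarted_event a m H t) - ?G a H\<bar> \<le> \<kappa>a t"
    by (rule prob_restarted_event_tendsto[of a m]) blast
  obtain \<kappa>b where \<kappa>b: "\<kappa>b \<longlonglongrightarrow> 0"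
    "\<And>H t. admissible H \<Longrightarrow> \<bar>M.prob (restarted_event b m H t) - ?G b H\<bar> \<le> \<kappa>b t"
    by (rule prob_restarted_event_tendsto[of b m]) blast
  have ev: "eventually (\<lambda>t. \<kappa>a t < e / 3) sequentially" "eventually (\<lambda>t. \<kappa>b t < e / 3) sequentially"
    "eventually (\<lambda>t. M.prob {\<omega> \<in> space M. t < T m \<omega>} < e / 3) sequentially"
    by (intro order_tendstoD(2)[OF \<kappa>a(1)] order_tendstoD(2)[OF \<kappa>b(1)]
      order_tendstoD(2)[OF prob_late_regeneration]; use \<open>0 < e\<close> in simp)+
  show ?thesis
    using ev
  proof eventually_elim
    case (elim t)
    show ?case
    proof (intro allI ballI)
      fix r A assume A: "A \<in> sets S"
      let ?H = "hit ({..r} \<times> A)"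
      let ?p = "\<P>(\<omega> in M. recursion f Z x t \<omega> \<le> r \<and> Z t \<omega> \<in> A)"
      let ?s = "stationary_prob M f Z T a b \<pi> ({..r} \<times> A)"
      have E: "{..r} \<times> A \<in> sets (borel \<Otimes>\<^sub>M S)" using A by auto
      note H = admissible_hit[OF E]
      have down: "(u, \<xi>) \<in> ?H l" if "\<xi> \<in> lists (space S)" "(v, \<xi>) \<in> ?H l" "u \<le> v" for l \<xi> u v
        using that flow_mono[OF that(1,3), of l]
        by (auto simp: hit_def space_pair_measure simp del: in_lists_conv_set)
      have G: "\<bar>?G y ?H - ?s\<bar> < e / 3" for y
      proof -
        have "\<bar>?G y ?H - ?s\<bar> = \<bar>(\<Sum>l. measure (kernel_power m y \<Otimes>\<^sub>M Q) (?H l))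
            - (\<Sum>l. measure (\<pi> \<Otimes>\<^sub>M Q) (?H l))\<bar> / mean_length"
          using mean_length_ge_1 by (simp add: stationary_prob_eq[OF \<pi> E] abs_divide flip: diff_divide_distrib)
        also have "\<dots> \<le> \<rho> ^ m"
          using suminf_admissible_diff[OF real_distribution_kernel_power \<pi>.real_distribution_axioms rate H down]
            mean_length_ge_1 by (simp add: divide_le_eq)
        finally show ?thesis using m by simp
      qed
      have rA: "{\<omega> \<in> space M. recursion f Z x t \<omega> \<le> r \<and> Z t \<omega> \<in> A} \<in> M.events"
      proof -
        have "(recursion f Z x t -` {..r} \<inter> space M) \<inter> (Z t -` A \<inter> space M) \<in> M.events"
          by (intro sets.Int measurable_sets[OF recursion_measurable[OF x]] measurable_sets[OF Z_measurable A]) auto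
        also have "(recursion f Z x t -` {..r} \<inter> space M) \<inter> (Z t -` A \<inter> space M)
            = {\<omega> \<in> space M. recursion f Z x t \<omega> \<le> r \<and> Z t \<omega> \<in> A}" by auto
        finally show ?thesis .
      qed
      have late: "{\<omega> \<in> space M. t < T m \<omega>} \<in> M.events" by measurable
      have "M.prob (restarted_event b m ?H t) \<le> ?p"
        by (rule M.finite_measure_mono[OF restarted_event_subset[OF x] rA])
      moreover have "?p \<le> M.prob ({\<omega> \<in> space M. t < T m \<omega>} \<union> restarted_event a m ?H t)"
        using subset_restarted_event[OF x, of m t r A] late restarted_event_measurable[OF H]
        by (intro M.finite_measure_mono) (auto simp: not_less)
      moreover have "\<dots> \<le> M.prob {\<omega> \<in> space M. t < T m \<omega>} + M.prob (restarted_event a m ?H t)"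
        by (rule measure_Un_le[OF late restarted_event_measurable[OF H]])
      ultimately show "\<bar>?p - ?s\<bar> \<le> e"
        using elim \<kappa>a(2)[OF H, of t] \<kappa>b(2)[OF H, of t] G[of a] G[of b] by linarith
    qed
  qed
qed

text \<open>Each term of the series is, as a function of \<open>B\<close>, a finite measure; the sum of these measures has
  total mass \<open>1\<close> because the probabilities \<open>P (\<tau>\<^sub>1 > l)\<close> add up to the mean cycle length.\<close>

lemma ex_stationary_distribution:
  assumes \<pi>: "distribution_on a b \<pi>"
  shows "\<exists>\<mu>. distribution_on a b \<mu> \<and>
    (\<forall>B\<in>sets borel. measure \<mu> B = stationary_prob M f Z T a b \<pi> (B \<times> space S))"
proof -
  interpret \<pi>: real_distribution \<pi> using \<pi> by (simp add: distribution_on_def)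
  interpret P: pair_prob_space \<pi> Q ..
  let ?H = "\<lambda>B. hit (B \<times> space S)"
  have H: "admissible (?H B)" if "B \<in> sets borel" for B
    using that by (intro admissible_hit) auto
  have sets_P: "P.events = sets (borel \<Otimes>\<^sub>M cycle_space S)"
    by (intro sets_pair_measure_cong) (simp_all add: sets_Q)
  have H_meas: "?H B l \<in> P.events" if "B \<in> sets borel" for B l
    using H[OF that] by (simp only: sets_P admissible_def)
  define \<mu>0 where "\<mu>0 B = (\<Sum>l. ennreal (1 / mean_length) * emeasure (\<pi> \<Otimes>\<^sub>M Q) (?H B l))" for B
  define \<mu> where "\<mu> = measure_of UNIV (sets borel) \<mu>0"
  have \<mu>0: "\<mu>0 B = ennreal (stationary_prob M f Z T a b \<pi> (B \<times> space S))" if B: "B \<in> sets borel" for B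
  proof -
    have s: "summable (\<lambda>l. measure (\<pi> \<Otimes>\<^sub>M Q) (?H B l))"
      by (rule summable_admissible[OF \<pi>.real_distribution_axioms H[OF B]])
    have "\<mu>0 B = (\<Sum>l. ennreal (1 / mean_length * measure (\<pi> \<Otimes>\<^sub>M Q) (?H B l)))"
      unfolding \<mu>0_def P.emeasure_eq_measure
      by (intro suminf_cong ennreal_mult[symmetric]) (use mean_length_ge_1 in auto)
    also have "\<dots> = ennreal (\<Sum>l. 1 / mean_length * measure (\<pi> \<Otimes>\<^sub>M Q) (?H B l))"
      using mean_length_ge_1 by (intro suminf_ennreal2 summable_mult s) auto
    also have "(\<Sum>l. 1 / mean_length * measure (\<pi> \<Otimes>\<^sub>M Q) (?H B l))
        = stationary_prob M f Z T a b \<pi> (B \<times> space S)"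
      using B by (subst suminf_mult[OF s]) (subst stationary_prob_eq[OF \<pi>], auto)
    finally show ?thesis .
  qed
  have nonneg: "0 \<le> stationary_prob M f Z T a b \<pi> (B \<times> space S)" if "B \<in> sets borel" for B
  proof -
    have "B \<times> space S \<in> sets (borel \<Otimes>\<^sub>M S)" using that by auto
    from stationary_prob_eq[OF \<pi> this] show ?thesis
      using mean_length_ge_1 suminf_nonneg[OF summable_admissible[OF \<pi>.real_distribution_axioms H[OF that]]]
      by simp
  qed
  have add: "countably_additive (sets borel) \<mu>0"
  proof (rule countably_additiveI)
    fix A :: "nat \<Rightarrow> real set"
    assume A: "range A \<subseteq> sets borel" "disjoint_family A" "\<Union> (range A) \<in> sets borel"
    have "(\<Sum>i. \<mu>0 (A i)) = (\<Sum>i. \<integral>\<^sup>+l. ennreal (1 / mean_length) * emeasure (\<pi> \<Otimes>\<^sub>M Q) (?H (A i) l) \<partial>count_space UNIV)"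
      by (simp add: \<mu>0_def nn_integral_count_space_nat)
    also have "\<dots> = (\<integral>\<^sup>+l. (\<Sum>i. ennreal (1 / mean_length) * emeasure (\<pi> \<Otimes>\<^sub>M Q) (?H (A i) l)) \<partial>count_space UNIV)"
      by (rule nn_integral_suminf[symmetric]) simp
    also have "\<dots> = (\<Sum>l. ennreal (1 / mean_length) * (\<Sum>i. emeasure (\<pi> \<Otimes>\<^sub>M Q) (?H (A i) l)))"
      by (simp add: nn_integral_count_space_nat)
    also have "\<dots> = \<mu>0 (\<Union> (range A))"
      unfolding \<mu>0_def
    proof (intro suminf_cong arg_cong[where f="\<lambda>u. ennreal (1 / mean_length) * u"])
      fix l
      have "(\<Sum>i. emeasure (\<pi> \<Otimes>\<^sub>M Q) (?H (A i) l)) = emeasure (\<pi> \<Otimes>\<^sub>M Q) (\<Union>i. ?H (A i) l)"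
        using A H_meas by (intro suminf_emeasure) (auto simp: disjoint_family_on_def hit_def)
      also have "(\<Union>i. ?H (A i) l) = ?H (\<Union> (range A)) l" by (auto simp: hit_def)
      finally show "(\<Sum>i. emeasure (\<pi> \<Otimes>\<^sub>M Q) (?H (A i) l)) = emeasure (\<pi> \<Otimes>\<^sub>M Q) (?H (\<Union> (range A)) l)" .
    qed
    finally show "(\<Sum>i. \<mu>0 (A i)) = \<mu>0 (\<Union> (range A))" .
  qed
  have sets_\<mu>: "sets \<mu> = sets borel" and space_\<mu>: "space \<mu> = UNIV"
    using sets.sigma_sets_eq[of borel] by (simp_all add: \<mu>_def)
  have em: "emeasure \<mu> B = \<mu>0 B" if "B \<in> sets borel" for B
    unfolding \<mu>_def
  proof (rule emeasure_measure_of_sigma)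
    show "sigma_algebra UNIV (sets borel)" using sets.sigma_algebra_axioms[of borel] by simp
    show "positive (sets borel) \<mu>0" by (simp add: positive_def \<mu>0_def hit_def)
  qed (use add that in auto)
  have total: "stationary_prob M f Z T a b \<pi> (B \<times> space S) = 1" if B: "B \<in> sets borel" "{a..b} \<subseteq> B" for B
  proof -
    have "?H B l = longer l" for l
      unfolding hit_def longer_def
      using B(2) flow_in nth_or_in_space[OF z0] by (fastforce simp: space_pair_measure)
    moreover have "B \<times> space S \<in> sets (borel \<Otimes>\<^sub>M S)" using B by auto
    ultimately show ?thesis
      using mean_length_ge_1 sums_unique[OF prob_length_greater_sums]
      by (simp add: stationary_prob_eq[OF \<pi>] measure_longer[OF \<pi>.real_distribution_axioms] del: One_nat_def)
  qed
  have meas: "measure \<mu> B = stationary_prob M f Z T a b \<pi> (B \<times> space S)" if "B \<in> sets borel" for B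
    using em[OF that] \<mu>0[OF that] nonneg[OF that] by (simp add: measure_def)
  have "emeasure \<mu> (space \<mu>) = 1" using em[of UNIV] \<mu>0[of UNIV] total[of UNIV] by (simp add: space_\<mu>)
  then have "real_distribution \<mu>"
    by (intro real_distribution.intro prob_spaceI) (auto simp: real_distribution_axioms_def sets_\<mu> space_\<mu>)
  then show ?thesis
    using meas total[of "{a..b}"] by (auto simp: distribution_on_def)
qed

end

theorem theorem2:
  fixes M :: "'w measure" and S :: "'z measure"
    and f :: "real \<Rightarrow> 'z \<Rightarrow> real"
    and Z :: "nat \<Rightarrow> 'w \<Rightarrow> 'z" and T :: "nat \<Rightarrow> 'w \<Rightarrow> nat"
    and a b c :: real
  assumes "prob_space M"
    and "a < b"
    and "(\<lambda>(x, z). f x z) \<in> restrict_space borel {a..b} \<Otimes>\<^sub>M S \<rightarrow>\<^sub>M restrict_space borel {a..b}"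
    and "\<And>z. z \<in> space S \<Longrightarrow> mono_on {a..b} (\<lambda>x. f x z)"
    and "regenerative M S Z T"
    and "integrable M (\<lambda>\<omega>. real (cycle_length T 1 \<omega>))"
    and "Gcd {n. \<P>(\<omega> in M. cycle_length T 1 \<omega> = n) > 0} = 1"
    and "c \<in> {a..b}"
    and "\<P>(\<omega> in M. aux_process f Z T b (T 1 \<omega> - T 0 \<omega>) \<omega> \<le> c) > 0"
    and "\<P>(\<omega> in M. aux_process f Z T a (T 1 \<omega> - T 0 \<omega>) \<omega> \<ge> c) > 0"
  shows "\<exists>\<pi>. distribution_on a b \<pi> \<and>
     (\<exists>C \<rho>. 0 < \<rho> \<and> \<rho> < 1 \<and>
        (\<forall>n. (SUP x\<in>{a..b}. uniform_dist (regen_distr M f Z T n x) \<pi>) \<le> C * \<rho> ^ n)) \<and>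
     (\<exists>\<mu>. distribution_on a b \<mu> \<and>
        (\<forall>B\<in>sets borel. measure \<mu> B = stationary_prob M f Z T a b \<pi> (B \<times> space S)) \<and>
        (\<forall>x\<in>{a..b}.
           (\<lambda>t. uniform_dist (distr M borel (recursion f Z x t)) \<mu>) \<longlonglongrightarrow> 0)) \<and>
     (\<forall>x\<in>{a..b}.
        (\<lambda>t. SUP r. SUP A\<in>sets S.
           \<bar>\<P>(\<omega> in M. recursion f Z x t \<omega> \<le> r \<and> Z t \<omega> \<in> A)
             - stationary_prob M f Z T a b \<pi> ({..r} \<times> A)\<bar>) \<longlonglongrightarrow> 0)"
proof -
  interpret M: prob_space M by fact
  \<comment> \<open>Any value of the driving sequence can fill the entries beyond the end of a cycle.\<close>
  obtain \<omega> where "\<omega> \<in> space M" using M.not_empty by blast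
  moreover have "Z 0 \<in> M \<rightarrow>\<^sub>M S" using assms(5) by (simp add: regenerative_def)
  ultimately have "Z 0 \<omega> \<in> space S" by (metis measurable_space)
  then interpret aperiodic_regenerative_recursion M S f a b "Z 0 \<omega>" Z T
    using assms by unfold_locales auto
  have ab_in: "a \<in> {a..b}" "b \<in> {a..b}" using \<open>a < b\<close> by auto
  have one_cycle: "aux_process f Z T y (T 1 \<omega> - T 0 \<omega>) \<omega> = cycle_map y (C 1 \<omega>)"
    if "\<omega> \<in> space M" "y \<in> {a..b}" for \<omega> y
    using aux_process_at_regeneration[OF that, of 1] by (simp add: future_def)
  have cm: "cycle_map y \<in> cycle_space S \<rightarrow>\<^sub>M borel" for y
    using measurable_compose[OF measurable_Pair1'[of y borel "cycle_space S"] measurable_cycle_map]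
    by simp
  define \<epsilon>1 where "\<epsilon>1 = measure Q {\<xi> \<in> space Q. cycle_map b \<xi> \<le> c}"
  define \<epsilon>2 where "\<epsilon>2 = measure Q {\<xi> \<in> space Q. c \<le> cycle_map a \<xi>}"
  have "{\<xi> \<in> space (cycle_space S). cycle_map b \<xi> \<le> c} \<in> sets (cycle_space S)"
    "{\<xi> \<in> space (cycle_space S). c \<le> cycle_map a \<xi>} \<in> sets (cycle_space S)"
    using cm by measurable
  then have "\<epsilon>1 = \<P>(\<omega> in M. aux_process f Z T b (T 1 \<omega> - T 0 \<omega>) \<omega> \<le> c)"
    "\<epsilon>2 = \<P>(\<omega> in M. aux_process f Z T a (T 1 \<omega> - T 0 \<omega>) \<omega> \<ge> c)"
    unfolding \<epsilon>1_def \<epsilon>2_def using one_cycle ab_in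
    by (simp_all only: measure_Q_eq cong: conj_cong)
  then have pos: "0 < \<epsilon>1" "0 < \<epsilon>2" using assms(9,10) by simp_all
  \<comment> \<open>The bound \<open>1 / 2\<close> keeps the rate \<open>1 - \<epsilon>\<close> positive when both probabilities equal \<open>1\<close>.\<close>
  define \<epsilon> where "\<epsilon> = min (1 / 2) (min \<epsilon>1 \<epsilon>2)"
  interpret splitting_kernel S f a b "Z 0 \<omega>" Q c \<epsilon>
  proof unfold_locales
    show "0 < \<epsilon>" "\<epsilon> < 1" using pos by (auto simp: \<epsilon>_def)
    show "\<epsilon> \<le> Q.prob {\<xi> \<in> space Q. cycle_map b \<xi> \<le> c}" "\<epsilon> \<le> Q.prob {\<xi> \<in> space Q. c \<le> cycle_map a \<xi>}"
      by (auto simp: \<epsilon>_def \<epsilon>1_def \<epsilon>2_def)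
  qed
  obtain \<pi> where \<pi>: "distribution_on a b \<pi>"
    and rate: "\<And>n y r. \<bar>cdf (kernel_power n y) r - cdf \<pi> r\<bar> \<le> (1 - \<epsilon>) ^ n"
    using ex_limit_distribution by blast
  have \<rho>: "0 \<le> 1 - \<epsilon>" "0 < 1 - \<epsilon>" "1 - \<epsilon> < 1" using \<epsilon> by auto
  note conv = uniform_convergence[OF \<pi> \<rho>(1,3) rate]
  obtain \<mu> where \<mu>: "distribution_on a b \<mu>"
    "\<And>B. B \<in> sets borel \<Longrightarrow> measure \<mu> B = stationary_prob M f Z T a b \<pi> (B \<times> space S)"
    using ex_stationary_distribution[OF \<pi>] by blast
  have 1: "(SUP x\<in>{a..b}. uniform_dist (regen_distr M f Z T n x) \<pi>) \<le> 1 * (1 - \<epsilon>) ^ n" for n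
  proof (rule cSUP_least)
    show "{a..b} \<noteq> {}" using ab_in by blast
    fix x assume "x \<in> {a..b}"
    then show "uniform_dist (regen_distr M f Z T n x) \<pi> \<le> 1 * (1 - \<epsilon>) ^ n"
      unfolding uniform_dist_def using rate by (intro cSUP_least) (auto simp: regen_distr_eq_kernel_power)
  qed
  have 2: "(\<lambda>t. uniform_dist (distr M borel (recursion f Z x t)) \<mu>) \<longlonglongrightarrow> 0" if x: "x \<in> {a..b}" for x
  proof (rule tendsto_0I_upto)
    fix e :: real assume "0 < e"
    from conv[OF x this]
    show "eventually (\<lambda>t. 0 \<le> uniform_dist (distr M borel (recursion f Z x t)) \<mu> \<and>
        uniform_dist (distr M borel (recursion f Z x t)) \<mu> \<le> e) sequentially"
    proof eventually_elim
      case (elim t)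
      have "\<bar>cdf (distr M borel (recursion f Z x t)) r - cdf \<mu> r\<bar> \<le> e" for r
      proof -
        have "cdf (distr M borel (recursion f Z x t)) r
            = \<P>(\<omega> in M. recursion f Z x t \<omega> \<le> r \<and> Z t \<omega> \<in> space S)"
          using Z_in unfolding cdf_def
          by (subst measure_distr[OF recursion_measurable[OF x]]) (auto intro!: arg_cong[where f=M.prob])
        moreover have "cdf \<mu> r = stationary_prob M f Z T a b \<pi> ({..r} \<times> space S)"
          unfolding cdf_def by (rule \<mu>(2)) simp
        ultimately show ?thesis using elim sets.top[of S] by simp
      qed
      then show ?case
        unfolding uniform_dist_def by (intro conjI SUP_between) auto
    qed
  qed
  have 3: "(\<lambda>t. SUP r. SUP A\<in>sets S. \<bar>\<P>(\<omega> in M. recursion f Z x t \<omega> \<le> r \<and> Z t \<omega> \<in> A)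
      - stationary_prob M f Z T a b \<pi> ({..r} \<times> A)\<bar>) \<longlonglongrightarrow> 0" if x: "x \<in> {a..b}" for x
  proof (rule tendsto_0I_upto)
    fix e :: real assume "0 < e"
    from conv[OF x this]
    show "eventually (\<lambda>t. 0 \<le> (SUP r. SUP A\<in>sets S. \<bar>\<P>(\<omega> in M. recursion f Z x t \<omega> \<le> r \<and> Z t \<omega> \<in> A)
          - stationary_prob M f Z T a b \<pi> ({..r} \<times> A)\<bar>) \<and>
        (SUP r. SUP A\<in>sets S. \<bar>\<P>(\<omega> in M. recursion f Z x t \<omega> \<le> r \<and> Z t \<omega> \<in> A)
          - stationary_prob M f Z T a b \<pi> ({..r} \<times> A)\<bar>) \<le> e) sequentially"
    proof eventually_elim
      case (elim t)
      have ne: "sets S \<noteq> {}" using sets.top[of S] by blast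
      show ?case
        by (intro conjI SUP_between ne) (use elim in auto)
    qed
  qed
  show ?thesis
    using \<pi> \<rho>(2,3) 1 \<mu> 2 3 by blast
qed

end
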